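(* Let $(\phi_t)$ be a semigroup of finite shift in $\mathbb{D}$ whose Koenigs domain is contained in the upper half-plane $\{\mathrm{Im}\,w>0\}$, and let $(T_t)$ be the induced semigroup of composition operators acting on the Bergman space $A^p_\alpha$, $p\ge1$, $\alpha>-1$. Then the point spectrum $\sigma_{p,\alpha}$ of the infinitesimal generator of $(T_t)$ is $\sigma_{p,\alpha}=\{it:t\ge0\}$.
   Context: $\mathbb{D}$ is the open unit disk. A semigroup in $\mathbb{D}$ is a family $(\phi_t)_{t\ge0}$ of holomorphic maps $\phi_t:\mathbb{D}\to\mathbb{D}$ with $\phi_0=\mathrm{id}$, $\phi_{t+s}=\phi_t\circ\phi_s$ for all $t,s\ge0$, and $\phi_t(z)\to z$ uniformly on compacta as $t\to0^+$. It is non-elliptic if there is $\tau\in\partial\mathbb{D}$ (the Denjoy–Wolff point) with $\phi_t(z)\to\tau$ as $t\to+\infty$ for all $z\in\mathbb{D}$. For a non-elliptic semigroup there is a univalent map $h:\mathbb{D}\to\mathbb{C}$, unique up to translation, the Koenigs function, with $h(\phi_t(z))=h(z)+t$ for all $t\ge0$, $z\in\mathbb{D}$; $h(\mathbb{D})$ is the Koenigs domain. A horodisk centered at $\tau$ is a disk contained in $\mathbb{D}$ internally tangent to $\partial\mathbb{D}$ at $\tau$. A non-elliptic semigroup is of finite shift if there is $z\in\mathbb{D}$ whose orbit $\{\phi_t(z):t\ge0\}$ does not intersect some horodisk centered at $\tau$. (Such semigroups have Koenigs domain contained in a horizontal half-plane.) $A^p_\alpha$ is the Banach space of holomorphic $f$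 on $\mathbb{D}$ with $\|f\|^p_{A^p_\alpha}=\int_{\mathbb{D}}|f(z)|^p(1-|z|^2)^\alpha\,dA(z)<+\infty$ ($dA$ normalized area measure). On $A^p_\alpha$, $T_t(f)=f\circ\phi_t$ is a strongly continuous semigroup of bounded operators; its infinitesimal generator is $\Gamma(f)=\lim_{t\to0^+}(T_t(f)-f)/t$ (norm limit), defined on those $f\in A^p_\alpha$ for which the limit exists in $A^p_\alpha$. The point spectrum is the set of eigenvalues $\lambda\in\mathbb{C}$ of $\Gamma$. *)

theory Defs
  imports "HOL-Complex_Analysis.Complex_Analysis"
begin

abbreviation unit_disk :: "complex set" ("\<bbbD>")
  where "\<bbbD> \<equiv> ball 0 1"

text \<open>Only the maps \<open>\<phi> t\<close> with \<open>t \<ge> 0\<close>, and their values on \<open>\<bbbD>\<close>, matter; everything else about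
  \<open>\<phi>\<close> is unconstrained.\<close>

definition disk_semigroup :: "(real \<Rightarrow> complex \<Rightarrow> complex) \<Rightarrow> bool" where
  "disk_semigroup \<phi> \<longleftrightarrow>
     (\<forall>t\<ge>0. \<phi> t holomorphic_on \<bbbD> \<and> \<phi> t ` \<bbbD> \<subseteq> \<bbbD>) \<and>
     (\<forall>z\<in>\<bbbD>. \<phi> 0 z = z) \<and>
     (\<forall>t\<ge>0. \<forall>s\<ge>0. \<forall>z\<in>\<bbbD>. \<phi> (t + s) z = \<phi> t (\<phi> s z)) \<and>
     (\<forall>K. compact K \<and> K \<subseteq> \<bbbD> \<longrightarrow> uniform_limit K \<phi> (\<lambda>z. z) (at_right 0))"

definition denjoy_wolff_point :: "(real \<Rightarrow> complex \<Rightarrow> complex) \<Rightarrow> complex \<Rightarrow> bool" where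
  "denjoy_wolff_point \<phi> \<tau> \<longleftrightarrow> \<tau> \<in> sphere 0 1 \<and> (\<forall>z\<in>\<bbbD>. ((\<lambda>t. \<phi> t z) \<longlongrightarrow> \<tau>) at_top)"

definition non_elliptic_semigroup :: "(real \<Rightarrow> complex \<Rightarrow> complex) \<Rightarrow> bool" where
  "non_elliptic_semigroup \<phi> \<longleftrightarrow> disk_semigroup \<phi> \<and> (\<exists>\<tau>. denjoy_wolff_point \<phi> \<tau>)"

definition koenigs_function :: "(real \<Rightarrow> complex \<Rightarrow> complex) \<Rightarrow> (complex \<Rightarrow> complex) \<Rightarrow> bool" where
  "koenigs_function \<phi> h \<longleftrightarrow>
     h holomorphic_on \<bbbD> \<and> inj_on h \<bbbD> \<and> (\<forall>t\<ge>0. \<forall>z\<in>\<bbbD>. h (\<phi> t z) = h z + of_real t)"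

text \<open>For \<open>\<bar>\<tau>\<bar> = 1\<close>, the disks contained in \<open>\<bbbD>\<close> and internally tangent to its boundary at \<open>\<tau>\<close> are
  exactly the \<open>horodisk \<tau> r\<close> with \<open>0 < r < 1\<close>; \<open>r\<close> is the Euclidean radius.\<close>

definition horodisk :: "complex \<Rightarrow> real \<Rightarrow> complex set" where
  "horodisk \<tau> r = ball (of_real (1 - r) * \<tau>) r"

definition finite_shift :: "(real \<Rightarrow> complex \<Rightarrow> complex) \<Rightarrow> bool" where
  "finite_shift \<phi> \<longleftrightarrow> non_elliptic_semigroup \<phi> \<and>
     (\<exists>\<tau>. denjoy_wolff_point \<phi> \<tau> \<and>
       (\<exists>z\<in>\<bbbD>. \<exists>r. 0 < r \<and> r < 1 \<and> (\<lambda>t. \<phi> t z) ` {0..} \<inter> horodisk \<tau> r = {}))"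

text \<open>Elements of the Bergman space are represented by functions on the whole plane, and two of
  them are identified when they agree on \<open>\<bbbD>\<close>.\<close>

definition bergman_space :: "real \<Rightarrow> real \<Rightarrow> (complex \<Rightarrow> complex) set" where
  "bergman_space p \<alpha> = {f. f holomorphic_on \<bbbD> \<and>
     set_integrable lborel \<bbbD> (\<lambda>z. norm (f z) powr p * (1 - (norm z)\<^sup>2) powr \<alpha>)}"

text \<open>The factor \<open>1 / pi\<close> normalizes the area measure. The value is meaningful only on
  \<^const>\<open>bergman_space\<close>: outside it the integral may take its default value \<open>0\<close>.\<close>

definition bergman_norm :: "real \<Rightarrow> real \<Rightarrow> (complex \<Rightarrow> complex) \<Rightarrow> real" where
  "bergman_norm p \<alpha> f =
     (1 / pi * (LINT z:\<bbbD>|lborel. norm (f z) powr p * (1 - (norm z)\<^sup>2) powr \<alpha>)) powr (1 / p)"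

text \<open>Norm convergence in the Bergman space; the membership conditions keep
  \<^const>\<open>bergman_norm\<close> away from its default value.\<close>

definition bergman_tendsto ::
  "real \<Rightarrow> real \<Rightarrow> ('t \<Rightarrow> complex \<Rightarrow> complex) \<Rightarrow> (complex \<Rightarrow> complex) \<Rightarrow> 't filter \<Rightarrow> bool" where
  "bergman_tendsto p \<alpha> F g \<F> \<longleftrightarrow>
     g \<in> bergman_space p \<alpha> \<and> (\<forall>\<^sub>F t in \<F>. F t \<in> bergman_space p \<alpha>) \<and>
     ((\<lambda>t. bergman_norm p \<alpha> (\<lambda>z. F t z - g z)) \<longlongrightarrow> 0) \<F>"

definition composition_semigroup ::
  "(real \<Rightarrow> complex \<Rightarrow> complex) \<Rightarrow> real \<Rightarrow> (complex \<Rightarrow> complex) \<Rightarrow> complex \<Rightarrow> complex" where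
  "composition_semigroup \<phi> t f = f \<circ> \<phi> t"

text \<open>The graph of the infinitesimal generator \<open>\<Gamma>\<close>: \<open>f\<close> is in the domain and \<open>\<Gamma> f = g\<close> on \<open>\<bbbD>\<close>.\<close>

definition bergman_generator ::
  "real \<Rightarrow> real \<Rightarrow> (real \<Rightarrow> complex \<Rightarrow> complex) \<Rightarrow> (complex \<Rightarrow> complex) \<Rightarrow> (complex \<Rightarrow> complex) \<Rightarrow> bool" where
  "bergman_generator p \<alpha> \<phi> f g \<longleftrightarrow> f \<in> bergman_space p \<alpha> \<and>
     bergman_tendsto p \<alpha>
       (\<lambda>t z. (composition_semigroup \<phi> t f z - f z) / of_real t) g (at_right 0)"

definition generator_point_spectrum ::
  "real \<Rightarrow> real \<Rightarrow> (real \<Rightarrow> complex \<Rightarrow> complex) \<Rightarrow> complex set" where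
  "generator_point_spectrum p \<alpha> \<phi> =
     {\<mu>. \<exists>f g. bergman_generator p \<alpha> \<phi> f g \<and> (\<exists>z\<in>\<bbbD>. f z \<noteq> 0) \<and> (\<forall>z\<in>\<bbbD>. g z = \<mu> * f z)}"

end

theory Submission imports Defs "HOL-Real_Asymp.Real_Asymp"
begin

text \<open>
  Write \<open>h\<close> for the Koenigs function, \<open>\<tau>\<close> for the Denjoy-Wolff point and \<open>W\<close> for the Cayley
  transform of the disk onto the upper half-plane that sends \<open>\<tau>\<close> to \<open>\<infinity>\<close>.

  In the coordinate \<open>h\<close> the semigroup is translation by \<open>t\<close>, so that the generator is the
  derivation \<open>f \<mapsto> f' / h'\<close>. An eigenvector therefore solves \<open>f' = \<mu> f h'\<close>, that is
  \<open>f = c exp (\<mu> h)\<close> (\<open>generator_eigenvector_is_exp_koenigs\<close>). Conversely \<open>exp (\<mu> h)\<close> is an eigenvector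
  as soon as it lies in the Bergman space (\<open>exp_koenigs_eigenvector\<close>). The question is thus for
  which \<open>\<mu>\<close> the function \<open>exp (\<mu> h)\<close> lies in the space. For \<open>\<mu> = i t\<close> with \<open>t \<ge> 0\<close> it is bounded,
  since \<open>Im h > 0\<close>, and bounded holomorphic functions belong to the space because \<open>\<alpha> > -1\<close>.

  For every other \<open>\<mu>\<close> there is a direction \<open>e\<close> in the open upper half-plane with
  \<open>Re (\<mu> e) > 0\<close>. Functions in the Bergman space grow at most like a power of \<open>1 / (1 - |z|)\<close>, hence at
  most like a power of \<open>s\<close> along the ray \<open>W = s e\<close> (\<open>bergman_growth_on_ray\<close>). On the other hand
  \<open>h / s\<close> tends to \<open>c e\<close> along this ray for a constant \<open>c > 0\<close> that does not depend on \<open>e\<close>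
  (\<open>koenigs_ray_asymptotics\<close>), so that \<open>|exp (\<mu> h)|\<close> grows exponentially in \<open>s\<close>, a contradiction.

  Existence of the limit \<open>c \<ge> 0\<close> is the Julia-Caratheodory theorem for \<open>h\<close> seen as a self-map of the
  half-plane. That \<open>c\<close> is positive is where the finite shift enters: \<open>Im W\<close> is at most an
  affine function of \<open>Im h\<close> (\<open>finite_shift_im_bound\<close>). To see this, note that \<open>Im W\<close> increases along
  orbits by the lemma of Julia and Wolff, and that finite shift says that it stays bounded along
  one orbit. By a normal family argument its limit along the orbits is a finite harmonic function
  dominating \<open>Im W\<close>. It is invariant under the semigroup, and a harmonic function of \<open>h\<close> that is
  invariant under horizontal translations is affine in \<open>Im h\<close>.
\<close>

section \<open>Area mean values of holomorphic functions\<close>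

lemma nn_integral_lborel_translation:
  fixes c :: "'a::euclidean_space"
  assumes [measurable]: "f \<in> borel_measurable borel"
  shows "(\<integral>\<^sup>+x. f (c + x) \<partial>lborel) = (\<integral>\<^sup>+x. f x \<partial>lborel)"
proof -
  have "(\<integral>\<^sup>+x. f x \<partial>lborel) = (\<integral>\<^sup>+x. f x \<partial>distr lborel borel ((+) c))"
    by (simp add: lborel_distr_plus)
  also have "\<dots> = (\<integral>\<^sup>+x. f (c + x) \<partial>lborel)"
    by (subst nn_integral_distr) auto
  finally show ?thesis ..
qed

lemma nn_integral_lborel_reflection:
  fixes c :: "'a::euclidean_space"
  assumes [measurable]: "f \<in> borel_measurable borel"
  shows "(\<integral>\<^sup>+x. f (c - x) \<partial>lborel) = (\<integral>\<^sup>+x. f x \<partial>lborel)"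
proof -
  have "(\<integral>\<^sup>+x. f x \<partial>lborel) =
      (\<integral>\<^sup>+x. f x \<partial>density (distr lborel borel (\<lambda>x. c + (-1) *\<^sub>R x)) (\<lambda>_. 1))"
    using lborel_affine[of "-1" c] by simp
  also have "\<dots> = (\<integral>\<^sup>+x. f (c - x) \<partial>lborel)"
    by (simp add: density_1 nn_integral_distr)
  finally show ?thesis ..
qed

text \<open>Uniqueness of translation-invariant measures, in the form of Tonelli's theorem: for the unit
  ball \<open>B\<close>, the integral of \<open>1\<^sub>A(u x) 1\<^sub>B(u x + y)\<close> over \<open>x\<close> and \<open>y\<close> is the measure of \<open>u\<^sup>-\<^sup>1 A\<close> times that of
  \<open>B\<close>. Shifting \<open>x\<close> by \<open>y / u\<close> turns it into the measure of \<open>A\<close> times that of \<open>u\<^sup>-\<^sup>1 B = B\<close>.\<close>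

lemma lborel_distr_rotation:
  fixes u :: complex
  assumes u: "norm u = 1"
  shows "distr lborel borel ((*) u) = lborel"
proof (rule measure_eqI)
  fix A assume "A \<in> sets (distr lborel borel ((*) u))"
  then have [measurable]: "A \<in> sets borel" by simp
  have u0: "u \<noteq> 0" using u by auto
  define B :: "complex set" where "B = ball 0 1"
  have [measurable]: "B \<in> sets borel" by (simp add: B_def)
  let ?I = "\<lambda>S x. indicator S x :: ennreal"
  have "emeasure (distr lborel borel ((*) u)) A * emeasure lborel B
      = (\<integral>\<^sup>+x. ?I A (u * x) \<partial>lborel) * emeasure lborel B"
    by (simp add: nn_integral_distr flip: nn_integral_indicator)
  also have "\<dots> = (\<integral>\<^sup>+x. ?I A (u * x) * (\<integral>\<^sup>+y. ?I B (u * x + y) \<partial>lborel) \<partial>lborel)"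
    by (subst nn_integral_lborel_translation) (auto simp: nn_integral_multc)
  also have "\<dots> = (\<integral>\<^sup>+x. (\<integral>\<^sup>+y. ?I A (u * x) * ?I B (u * x + y) \<partial>lborel) \<partial>lborel)"
    by (subst nn_integral_cmult) auto
  also have "\<dots> = (\<integral>\<^sup>+y. (\<integral>\<^sup>+x. ?I A (u * x) * ?I B (u * x + y) \<partial>lborel) \<partial>lborel)"
    by (rule lborel_pair.Fubini') measurable
  also have "\<dots> = (\<integral>\<^sup>+y. (\<integral>\<^sup>+x. ?I A (u * x - y) * ?I B (u * x) \<partial>lborel) \<partial>lborel)"
  proof (rule nn_integral_cong)
    fix y :: complex
    have "(\<integral>\<^sup>+x. ?I A (u * x - y) * ?I B (u * x) \<partial>lborel)
        = (\<integral>\<^sup>+x. ?I A (u * (y / u + x) - y) * ?I B (u * (y / u + x)) \<partial>lborel)"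
      by (rule nn_integral_lborel_translation[symmetric]) measurable
    also have "\<dots> = (\<integral>\<^sup>+x. ?I A (u * x) * ?I B (u * x + y) \<partial>lborel)"
      using u0 by (simp add: algebra_simps)
    finally show "(\<integral>\<^sup>+x. ?I A (u * x) * ?I B (u * x + y) \<partial>lborel)
        = (\<integral>\<^sup>+x. ?I A (u * x - y) * ?I B (u * x) \<partial>lborel)" ..
  qed
  also have "\<dots> = (\<integral>\<^sup>+x. (\<integral>\<^sup>+y. ?I A (u * x - y) * ?I B (u * x) \<partial>lborel) \<partial>lborel)"
    by (rule lborel_pair.Fubini'[symmetric]) measurable
  also have "\<dots> = (\<integral>\<^sup>+x. (\<integral>\<^sup>+y. ?I A (u * x - y) \<partial>lborel) * ?I B (u * x) \<partial>lborel)"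
    by (subst nn_integral_multc) auto
  also have "\<dots> = (\<integral>\<^sup>+x. emeasure lborel A * ?I B (u * x) \<partial>lborel)"
    by (subst nn_integral_lborel_reflection) auto
  also have "\<dots> = (\<integral>\<^sup>+x. emeasure lborel A * ?I B x \<partial>lborel)"
    using u by (intro nn_integral_cong) (auto simp: B_def indicator_def norm_mult)
  also have "\<dots> = emeasure lborel A * emeasure lborel B"
    by (subst nn_integral_cmult) auto
  finally have *: "emeasure lborel B * emeasure (distr lborel borel ((*) u)) A
      = emeasure lborel B * emeasure lborel A" by (simp add: mult.commute)
  have "emeasure lborel B = ennreal pi"
    by (simp add: B_def emeasure_ball unit_ball_vol_2)
  then have "emeasure lborel B \<noteq> 0 \<and> emeasure lborel B \<noteq> \<infinity>" by auto
  with * show "emeasure (distr lborel borel ((*) u)) A = emeasure lborel A"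
    by (auto simp: ennreal_mult_cancel_left)
qed simp

lemma norm_le_circle_average:
  fixes G :: "complex \<Rightarrow> complex"
  assumes "G holomorphic_on cball 0 1"
  shows "ennreal (norm (G 0)) \<le> (\<integral>\<^sup>+s\<in>{0..1}. ennreal (norm (G (exp (2 * of_real pi * \<i> * of_real s)))) \<partial>lborel)"
proof -
  let ?e = "\<lambda>s. exp (2 * of_real pi * \<i> * of_real s) :: complex"
  have "((\<lambda>u. G u / (u - 0)) has_contour_integral (2 * of_real pi * \<i> * G 0)) (circlepath 0 1)"
    by (rule Cauchy_integral_circlepath_simple) (use assms in auto)
  then have "((\<lambda>s. G (?e s) / ?e s * (2 * of_real pi * \<i> * ?e s)) has_integral (2 * of_real pi * \<i> * G 0)) {0..1}"
    unfolding has_contour_integral vector_derivative_circlepath by (simp add: circlepath)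
  from has_integral_mult_right[OF this, of "1 / (2 * of_real pi * \<i>)"]
  have I: "((\<lambda>s. G (?e s)) has_integral G 0) {0..1}" by simp
  have cont: "continuous_on {0..1} (\<lambda>s. G (?e s))"
  proof (rule continuous_on_compose2[OF holomorphic_on_imp_continuous_on[OF assms]])
    show "continuous_on {0..1} ?e" by (intro continuous_intros)
    show "?e ` {0..1} \<subseteq> cball 0 1" by auto
  qed
  then have int: "(\<lambda>s. norm (G (?e s))) integrable_on {0..1}"
    by (intro integrable_continuous_real continuous_on_norm)
  have "norm (integral {0..1} (\<lambda>s. G (?e s))) \<le> integral {0..1} (\<lambda>s. norm (G (?e s)))"
    using I int by (intro integral_norm_bound_integral) auto
  then have "ennreal (norm (G 0)) \<le> ennreal (integral {0..1} (\<lambda>s. norm (G (?e s))))"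
    using I by (simp add: integral_unique ennreal_leI)
  also have "ennreal (integral {0..1} (\<lambda>s. norm (G (?e s)))) = (\<integral>\<^sup>+s\<in>{0..1}. ennreal (norm (G (?e s))) \<partial>lborel)"
    by (rule nn_integral_has_integral_lebesgue'[symmetric]) (use int in auto)
  finally show ?thesis .
qed

text \<open>The circle estimate holds on each circle around \<open>z\<close>. Instead of polar coordinates, the integral over
  the disc is averaged over all rotations of the disc, which leave it unchanged.\<close>

lemma norm_le_disc_average:
  fixes F :: "complex \<Rightarrow> complex"
  assumes hol: "F holomorphic_on cball z r" and r: "r \<ge> 0"
  shows "ennreal (norm (F z) * (pi * r\<^sup>2)) \<le> (\<integral>\<^sup>+\<zeta>\<in>cball z r. ennreal (norm (F \<zeta>)) \<partial>lborel)"
proof -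
  \<comment> \<open>the cut-off makes \<open>g\<close> Borel measurable, as \<open>F\<close> is arbitrary outside the disc\<close>
  define g where "g \<zeta> = ennreal (indicator (cball z r) \<zeta> *\<^sub>R norm (F \<zeta>))" for \<zeta>
  have "continuous_on (cball z r) (\<lambda>\<zeta>. norm (F \<zeta>))"
    by (intro continuous_on_norm holomorphic_on_imp_continuous_on hol)
  then have [measurable]: "g \<in> borel_measurable borel"
    unfolding g_def by (intro measurable_compose[OF borel_measurable_continuous_on_indicator]) auto
  define e where "e s = exp (2 * of_real pi * \<i> * of_real s)" for s :: real
  have [measurable]: "e \<in> borel_measurable borel"
    unfolding e_def by (intro borel_measurable_continuous_onI continuous_intros)
  have norm_e: "norm (e s) = 1" for s by (simp add: e_def)
  have circle: "ennreal (norm (F z)) * indicator (cball 0 r) \<zeta> \<le>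
      (\<integral>\<^sup>+s. indicator {0..1} s * g (z + e s * \<zeta>) \<partial>lborel)" for \<zeta>
  proof (cases "\<zeta> \<in> cball 0 r")
    case True
    have "norm x * norm \<zeta> \<le> r" if "norm x \<le> 1" for x :: complex
      using mult_mono[OF that, of "norm \<zeta>" r] True by simp
    then have "(\<lambda>x. F (z + x * \<zeta>)) holomorphic_on cball 0 1"
      by (intro holomorphic_on_compose_gen[OF _ hol, unfolded o_def] holomorphic_intros)
        (auto simp: dist_norm norm_mult)
    from norm_le_circle_average[OF this]
    have "ennreal (norm (F z)) \<le> (\<integral>\<^sup>+s\<in>{0..1}. ennreal (norm (F (z + e s * \<zeta>))) \<partial>lborel)"
      by (simp add: e_def)
    also have "\<dots> = (\<integral>\<^sup>+s. indicator {0..1} s * g (z + e s * \<zeta>) \<partial>lborel)"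
      using True by (intro nn_integral_cong) (auto simp: g_def dist_norm norm_mult norm_e mult.commute)
    finally show ?thesis using True by simp
  qed auto
  have "ennreal (norm (F z) * (pi * r\<^sup>2)) = ennreal (norm (F z)) * emeasure lborel (cball (0::complex) r)"
    using r by (simp add: emeasure_cball unit_ball_vol_2 ennreal_mult')
  also have "\<dots> = (\<integral>\<^sup>+\<zeta>. ennreal (norm (F z)) * indicator (cball (0::complex) r) \<zeta> \<partial>lborel)"
    by (simp add: nn_integral_cmult_indicator)
  also have "\<dots> \<le> (\<integral>\<^sup>+\<zeta>. (\<integral>\<^sup>+s. indicator {0..1} s * g (z + e s * \<zeta>) \<partial>lborel) \<partial>lborel)"
    by (intro nn_integral_mono circle)
  also have "\<dots> = (\<integral>\<^sup>+s. (\<integral>\<^sup>+\<zeta>. indicator {0..1} s * g (z + e s * \<zeta>) \<partial>lborel) \<partial>lborel)"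
    by (rule lborel_pair.Fubini') measurable
  also have "\<dots> = (\<integral>\<^sup>+s. indicator {0..1::real} s * (\<integral>\<^sup>+\<zeta>. g \<zeta> \<partial>lborel) \<partial>lborel)"
  proof (rule nn_integral_cong)
    fix s :: real
    have "(\<integral>\<^sup>+\<zeta>. g (z + e s * \<zeta>) \<partial>lborel) = (\<integral>\<^sup>+\<zeta>. g (z + \<zeta>) \<partial>distr lborel borel ((*) (e s)))"
      by (simp add: nn_integral_distr)
    also have "\<dots> = (\<integral>\<^sup>+\<zeta>. g \<zeta> \<partial>lborel)"
      by (simp add: lborel_distr_rotation norm_e nn_integral_lborel_translation)
    finally show "(\<integral>\<^sup>+\<zeta>. indicator {0..1} s * g (z + e s * \<zeta>) \<partial>lborel)
        = indicator {0..1} s * (\<integral>\<^sup>+\<zeta>. g \<zeta> \<partial>lborel)"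
      by (subst nn_integral_cmult) auto
  qed
  also have "\<dots> = (\<integral>\<^sup>+\<zeta>. g \<zeta> \<partial>lborel)"
    by (subst nn_integral_multc) auto
  also have "\<dots> = (\<integral>\<^sup>+\<zeta>\<in>cball z r. ennreal (norm (F \<zeta>)) \<partial>lborel)"
    by (intro nn_integral_cong) (auto simp: g_def indicator_def)
  finally show ?thesis .
qed

section \<open>Point evaluations on the Bergman space\<close>

lemma bergman_norm_nonneg: "bergman_norm p \<alpha> f \<ge> 0"
  by (simp add: bergman_norm_def)

lemma bergman_norm_powr:
  assumes "p > 0"
  shows "bergman_norm p \<alpha> f powr p =
    (LINT z:\<bbbD>|lborel. norm (f z) powr p * (1 - (norm z)\<^sup>2) powr \<alpha>) / pi"
proof -
  have "(LINT z:\<bbbD>|lborel. norm (f z) powr p * (1 - (norm z)\<^sup>2) powr \<alpha>) \<ge> 0"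
    unfolding set_lebesgue_integral_def by (intro integral_nonneg_AE) (auto simp: indicator_def)
  then show ?thesis using assms by (simp add: bergman_norm_def powr_powr)
qed

text \<open>A substitute for Jensen's inequality: it passes from the mean of \<open>|f|\<close> to that of \<open>|f|\<^sup>p\<close> at the cost
  of the arbitrarily small error \<open>\<epsilon>\<close>.\<close>

lemma le_add_scaled_powr:
  fixes x \<epsilon> p :: real
  assumes "x \<ge> 0" "\<epsilon> > 0" "p \<ge> 1"
  shows "x \<le> \<epsilon> + \<epsilon> powr (1 - p) * x powr p"
proof (cases "x \<le> \<epsilon>")
  case True
  then show ?thesis using assms by (simp add: add_increasing2)
next
  case False
  then have x: "x > 0" using assms by linarith
  then have "x = x powr (1 - p) * x powr p"
    by (simp flip: powr_add)
  also have "\<dots> \<le> \<epsilon> powr (1 - p) * x powr p"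
    using False assms by (intro mult_right_mono powr_mono2') auto
  finally show ?thesis using assms by linarith
qed

text \<open>On the disc of radius \<open>r = (1 - |z|) / 2\<close> around \<open>z\<close> the weight is at least \<open>r\<close> to the power \<open>|\<alpha>|\<close>, so
  that the mean value inequality on this disc can be compared with the norm. The bound serves twice:
  with small \<open>\<epsilon>\<close> it shows that norm convergence implies pointwise convergence, and with \<open>\<epsilon> = 1\<close> it
  limits the growth at the boundary to a power of \<open>1 / (1 - |z|)\<close>.\<close>

lemma bergman_point_evaluation:
  assumes f: "f \<in> bergman_space p \<alpha>" and p: "p \<ge> 1" and z: "z \<in> \<bbbD>" and \<epsilon>: "\<epsilon> > 0"
  shows "norm (f z) \<le> \<epsilon> +
    \<epsilon> powr (1 - p) * ((1 - norm z) / 2) powr (- (\<bar>\<alpha>\<bar> + 2)) * bergman_norm p \<alpha> f powr p"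
proof -
  define r where "r = (1 - norm z) / 2"
  define w where "w \<zeta> = norm (f \<zeta>) powr p * (1 - (norm \<zeta>)\<^sup>2) powr \<alpha>" for \<zeta>
  define K where "K = \<epsilon> powr (1 - p) * r powr (- \<bar>\<alpha>\<bar>)"
  have r: "0 < r" "r \<le> 1" using z norm_ge_zero[of z] by (auto simp: r_def simp del: norm_ge_zero)
  have hol: "f holomorphic_on \<bbbD>" and int: "set_integrable lborel \<bbbD> w"
    using f by (auto simp: bergman_space_def w_def[abs_def])
  have "norm z + r = 1 - r" by (simp add: r_def field_simps)
  then have "norm z + r < 1" using r by linarith
  then have sub: "cball z r \<subseteq> \<bbbD>" by (simp add: cball_subset_ball_iff dist_norm)
  have w_nonneg: "w \<zeta> \<ge> 0" for \<zeta> by (simp add: w_def)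
  have pw: "norm (f \<zeta>) \<le> \<epsilon> + K * w \<zeta>" if "\<zeta> \<in> cball z r" for \<zeta>
  proof -
    have "norm \<zeta> \<le> norm z + r"
      using that norm_triangle_ineq2[of \<zeta> z] by (simp add: dist_norm norm_minus_commute)
    then have n: "r \<le> 1 - norm \<zeta>" by (simp add: r_def field_simps)
    have "(norm \<zeta>)\<^sup>2 \<le> norm \<zeta>"
      using n r mult_left_le[of "norm \<zeta>" "norm \<zeta>"] by (simp add: power2_eq_square)
    then have weight: "r \<le> 1 - (norm \<zeta>)\<^sup>2" "1 - (norm \<zeta>)\<^sup>2 \<le> 1"
      using n zero_le_power2[of "norm \<zeta>"] by linarith+
    have "r powr \<bar>\<alpha>\<bar> \<le> (1 - (norm \<zeta>)\<^sup>2) powr \<bar>\<alpha>\<bar>"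
      using weight r by (intro powr_mono2) auto
    also have "\<dots> \<le> (1 - (norm \<zeta>)\<^sup>2) powr \<alpha>"
      using weight r by (intro powr_mono') auto
    finally have "1 \<le> r powr (- \<bar>\<alpha>\<bar>) * (1 - (norm \<zeta>)\<^sup>2) powr \<alpha>"
      using r by (simp add: powr_minus_divide pos_le_divide_eq)
    then have W: "norm (f \<zeta>) powr p \<le> r powr (- \<bar>\<alpha>\<bar>) * w \<zeta>"
      using mult_left_mono[of 1 "r powr (- \<bar>\<alpha>\<bar>) * (1 - (norm \<zeta>)\<^sup>2) powr \<alpha>" "norm (f \<zeta>) powr p"]
      by (simp add: w_def mult.left_commute)
    have "norm (f \<zeta>) \<le> \<epsilon> + \<epsilon> powr (1 - p) * norm (f \<zeta>) powr p"
      using \<epsilon> p by (intro le_add_scaled_powr) auto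
    also have "\<dots> \<le> \<epsilon> + K * w \<zeta>"
      using mult_left_mono[OF W, of "\<epsilon> powr (1 - p)"] by (simp add: K_def mult.assoc)
    finally show ?thesis .
  qed
  have K: "K \<ge> 0" by (simp add: K_def)
  define I where "I = (LINT \<zeta>:\<bbbD>|lborel. w \<zeta>)"
  have I: "I \<ge> 0" unfolding I_def set_lebesgue_integral_def
    by (intro integral_nonneg_AE) (auto simp: w_nonneg indicator_def)
  define g where "g \<zeta> = ennreal (indicator \<bbbD> \<zeta> *\<^sub>R w \<zeta>)" for \<zeta>
  have [measurable]: "cball z r \<in> sets borel" by simp
  have [measurable]: "g \<in> borel_measurable lborel"
    unfolding g_def by (intro measurable_compose[OF _ measurable_ennreal] borel_measurable_integrable)
      (use int in \<open>simp add: set_integrable_def\<close>)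
  have "ennreal (norm (f z) * (pi * r\<^sup>2)) \<le> (\<integral>\<^sup>+\<zeta>\<in>cball z r. ennreal (norm (f \<zeta>)) \<partial>lborel)"
    by (rule norm_le_disc_average) (use r hol sub in \<open>auto intro: holomorphic_on_subset\<close>)
  also have "\<dots> \<le> (\<integral>\<^sup>+\<zeta>. ennreal \<epsilon> * indicator (cball z r) \<zeta> + ennreal K * g \<zeta> \<partial>lborel)"
  proof (rule nn_integral_mono)
    fix \<zeta>
    show "ennreal (norm (f \<zeta>)) * indicator (cball z r) \<zeta>
      \<le> ennreal \<epsilon> * indicator (cball z r) \<zeta> + ennreal K * g \<zeta>"
    proof (cases "\<zeta> \<in> cball z r")
      case True
      then have "\<zeta> \<in> \<bbbD>" using sub by blast
      then show ?thesis
        using ennreal_leI[OF pw[OF True]] True \<epsilon> K w_nonneg[of \<zeta>]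
        by (simp add: g_def ennreal_mult')
    qed auto
  qed
  also have "\<dots> = ennreal \<epsilon> * emeasure lborel (cball z r) +
      ennreal K * (\<integral>\<^sup>+\<zeta>. g \<zeta> \<partial>lborel)"
    by (subst nn_integral_add) (simp_all add: nn_integral_cmult_indicator nn_integral_cmult)
  also have "(\<integral>\<^sup>+\<zeta>. g \<zeta> \<partial>lborel) = ennreal I"
    unfolding g_def I_def set_lebesgue_integral_def
    by (rule nn_integral_eq_integral) (use int w_nonneg in \<open>auto simp: set_integrable_def indicator_def\<close>)
  also have "ennreal \<epsilon> * emeasure lborel (cball z r) + ennreal K * ennreal I = ennreal (\<epsilon> * (pi * r\<^sup>2) + K * I)"
    using r \<epsilon> K I by (simp add: emeasure_cball unit_ball_vol_2 ennreal_mult')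
  finally have "norm (f z) * (pi * r\<^sup>2) \<le> \<epsilon> * (pi * r\<^sup>2) + K * I"
    using r \<epsilon> K I by (subst (asm) ennreal_le_iff) auto
  then have "norm (f z) \<le> (\<epsilon> * (pi * r\<^sup>2) + K * I) / (pi * r\<^sup>2)"
    using r by (simp add: pos_le_divide_eq)
  also have "\<dots> = \<epsilon> + K * (1 / r\<^sup>2) * (I / pi)"
    using r by (simp add: add_divide_distrib)
  also have "K * (1 / r\<^sup>2) = \<epsilon> powr (1 - p) * r powr (- (\<bar>\<alpha>\<bar> + 2))"
    using r powr_add[of r "- \<bar>\<alpha>\<bar>" "- 2"] powr_minus_divide[of r 2] by (simp add: K_def)
  also have "I / pi = bergman_norm p \<alpha> f powr p"
    using p by (simp add: bergman_norm_powr I_def w_def)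
  finally show ?thesis by (simp add: r_def)
qed

lemma bergman_integrand_measurable:
  assumes "f holomorphic_on \<bbbD>"
  shows "set_borel_measurable borel \<bbbD> (\<lambda>z. norm (f z) powr p * (1 - (norm z)\<^sup>2) powr \<alpha>)"
proof -
  have "continuous_on \<bbbD> f" using assms by (rule holomorphic_on_imp_continuous_on)
  then have "continuous_on \<bbbD> (\<lambda>z. norm (f z))" by (rule continuous_on_norm)
  then have [measurable]: "(\<lambda>z. indicator \<bbbD> z *\<^sub>R norm (f z)) \<in> borel_measurable borel"
    by (intro borel_measurable_continuous_on_indicator) auto
  have [measurable]: "\<bbbD> \<in> sets borel" by simp
  \<comment> \<open>the cut-off goes inside the power because \<open>f\<close> itself may fail to be measurable outside the disk\<close>
  have "(\<lambda>z. (indicator \<bbbD> z *\<^sub>R norm (f z)) powr p * (indicator \<bbbD> z * (1 - (norm z)\<^sup>2) powr \<alpha>)) \<in> borel_measurable borel"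
    by (intro borel_measurable_times powr_real_measurable) measurable
  also have "(\<lambda>z. (indicator \<bbbD> z *\<^sub>R norm (f z)) powr p * (indicator \<bbbD> z * (1 - (norm z)\<^sup>2) powr \<alpha>))
      = (\<lambda>z. indicator \<bbbD> z *\<^sub>R (norm (f z) powr p * (1 - (norm z)\<^sup>2) powr \<alpha>))"
    by (auto simp: indicator_def)
  finally show ?thesis by (simp add: set_borel_measurable_def)
qed

lemma bergman_space_diff:
  assumes f: "f \<in> bergman_space p \<alpha>" and g: "g \<in> bergman_space p \<alpha>" and p: "p \<ge> 1"
  shows "(\<lambda>z. f z - g z) \<in> bergman_space p \<alpha>"
proof -
  have holf: "f holomorphic_on \<bbbD>" and holg: "g holomorphic_on \<bbbD>"
    using f g by (auto simp: bergman_space_def)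
  then have hol: "(\<lambda>z. f z - g z) holomorphic_on \<bbbD>" by (intro holomorphic_intros)
  let ?W = "\<lambda>z. (1 - (norm z)\<^sup>2) powr \<alpha> :: real"
  have "set_integrable lborel \<bbbD> (\<lambda>z. 2 powr p * (norm (f z) powr p * ?W z + norm (g z) powr p * ?W z))"
    using f g by (intro set_integrable_mult_right set_integral_add) (auto simp: bergman_space_def)
  then have "set_integrable lborel \<bbbD> (\<lambda>z. norm (f z - g z) powr p * ?W z)"
  proof (rule set_integrable_bound)
    show "set_borel_measurable lborel \<bbbD> (\<lambda>z. norm (f z - g z) powr p * ?W z)"
      using bergman_integrand_measurable[OF hol] by (simp add: set_borel_measurable_def)
    have "norm (f z - g z) powr p \<le> 2 powr p * (norm (f z) powr p + norm (g z) powr p)" for z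
    proof -
      define M where "M = max (norm (f z)) (norm (g z))"
      have "norm (f z - g z) \<le> 2 * M"
        using norm_triangle_ineq4[of "f z" "g z"] by (simp add: M_def)
      then have "norm (f z - g z) powr p \<le> (2 * M) powr p"
        using p by (intro powr_mono2) auto
      also have "\<dots> = 2 powr p * M powr p" by (simp add: powr_mult M_def)
      also have "M powr p \<le> norm (f z) powr p + norm (g z) powr p"
        by (simp add: M_def max_def)
      finally show ?thesis by simp
    qed
    then have "norm (f z - g z) powr p * ?W z \<le> 2 powr p * (norm (f z) powr p + norm (g z) powr p) * ?W z" for z
      by (intro mult_right_mono) auto
    then show "AE z in lborel. z \<in> \<bbbD> \<longrightarrow> norm (norm (f z - g z) powr p * ?W z)
        \<le> norm (2 powr p * (norm (f z) powr p * ?W z + norm (g z) powr p * ?W z))"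
      by (auto simp: algebra_simps)
  qed
  with hol show ?thesis by (simp add: bergman_space_def)
qed

lemma bergman_tendsto_imp_pointwise:
  assumes lim: "bergman_tendsto p \<alpha> F g \<F>" and p: "p \<ge> 1" and z: "z \<in> \<bbbD>"
  shows "((\<lambda>t. F t z) \<longlongrightarrow> g z) \<F>"
proof (rule tendstoI)
  fix e :: real assume e: "e > 0"
  have g: "g \<in> bergman_space p \<alpha>" using lim by (simp add: bergman_tendsto_def)
  define C where "C = (e / 2) powr (1 - p) * ((1 - norm z) / 2) powr (- (\<bar>\<alpha>\<bar> + 2))"
  have "((\<lambda>t. C * bergman_norm p \<alpha> (\<lambda>z. F t z - g z) powr p) \<longlongrightarrow> C * 0 powr p) \<F>"
    using lim p by (intro tendsto_intros tendsto_powr') (auto simp: bergman_tendsto_def bergman_norm_nonneg)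
  then have "\<forall>\<^sub>F t in \<F>. C * bergman_norm p \<alpha> (\<lambda>z. F t z - g z) powr p < e / 2"
    by (rule order_tendstoD(2)) (use e p in auto)
  moreover have "\<forall>\<^sub>F t in \<F>. F t \<in> bergman_space p \<alpha>"
    using lim by (simp add: bergman_tendsto_def)
  ultimately show "\<forall>\<^sub>F t in \<F>. dist (F t z) (g z) < e"
  proof (rule eventually_elim2)
    fix t
    assume elim: "C * bergman_norm p \<alpha> (\<lambda>z. F t z - g z) powr p < e / 2" "F t \<in> bergman_space p \<alpha>"
    then have "(\<lambda>z. F t z - g z) \<in> bergman_space p \<alpha>" using p g by (intro bergman_space_diff)
    from bergman_point_evaluation[OF this p z, of "e / 2"] e elim
    show "dist (F t z) (g z) < e" by (simp add: dist_norm C_def)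
  qed
qed

section \<open>Bounded functions and exponentials of the Koenigs function\<close>

lemma one_half_power_eq_powr: "(1 / 2 :: real) ^ k = 2 powr (- real k)"
  by (simp add: powr_minus powr_realpow power_one_over inverse_eq_divide)

text \<open>The annuli \<open>A k\<close> shrink to the boundary: \<open>A k\<close>, where \<open>1 - |z|\<^sup>2\<close> is at most \<open>2\<close> to the power \<open>-k\<close>, has area
  \<open>\<pi>\<close> times that power, so the integral is dominated by a geometric series of ratio \<open>2\<close> to the power
  \<open>\<beta> - 1\<close>.\<close>

lemma nn_integral_disc_weight_finite:
  fixes \<beta> :: real
  assumes \<beta>: "0 \<le> \<beta>" "\<beta> < 1"
  shows "(\<integral>\<^sup>+z\<in>\<bbbD>. ennreal ((1 - (norm z)\<^sup>2) powr (- \<beta>)) \<partial>(lborel :: complex measure)) < \<infinity>"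
proof -
  define A :: "nat \<Rightarrow> complex set" where "A k = \<bbbD> - ball 0 (sqrt (1 - (1/2)^k))" for k
  have emA: "emeasure lborel (A k) = ennreal (pi * (1/2)^k)" for k
  proof -
    have k: "(1/2::real)^k \<le> 1" by (simp add: power_le_one)
    then have "emeasure lborel (A k) = emeasure lborel \<bbbD> - emeasure lborel (ball (0::complex) (sqrt (1 - (1/2)^k)))"
      unfolding A_def by (intro emeasure_Diff subset_ball) (auto simp: emeasure_ball unit_ball_vol_2 ennreal_mult'[symmetric])
    also have "\<dots> = ennreal pi - ennreal (pi * (1 - (1/2)^k))"
      using k by (simp add: emeasure_ball unit_ball_vol_2 ennreal_mult'[symmetric])
    also have "\<dots> = ennreal (pi * (1/2)^k)"
      using k by (subst ennreal_minus) (auto simp: right_diff_distrib)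
    finally show ?thesis .
  qed
  have pw: "ennreal ((1 - (norm z)\<^sup>2) powr (- \<beta>)) * indicator \<bbbD> z
      \<le> (\<Sum>k. ennreal (2 powr (\<beta> * (real k + 1))) * indicator (A k) z)" for z :: complex
  proof (cases "z \<in> \<bbbD>")
    case True
    define x where "x = 1 - (norm z)\<^sup>2"
    have "(norm z)\<^sup>2 < 1" using True by (simp add: power_less_one_iff abs_square_less_1)
    then have x: "0 < x" "x \<le> 1" by (auto simp: x_def)
    \<comment> \<open>\<open>A k\<close> is the last of the shrinking annuli that contains \<open>z\<close>\<close>
    define k where "k = (LEAST k. (1/2::real)^(k+1) < x)"
    have "\<exists>k. (1/2::real)^k < x" using x by (intro real_arch_pow_inv) auto
    then obtain k' where "(1/2::real)^k' < x" by blast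
    then have "(1/2::real)^(k'+1) < x" by (rule le_less_trans[rotated]) (simp add: power_decreasing)
    then have k1: "(1/2::real)^(k+1) < x" unfolding k_def by (rule LeastI)
    have k2: "x \<le> (1/2::real)^k"
    proof (cases k)
      case (Suc j)
      then have "\<not> (1/2::real)^(j+1) < x" using not_less_Least[of j "\<lambda>k. (1/2::real)^(k+1) < x"] by (simp add: k_def)
      then show ?thesis using Suc by simp
    qed (use x in auto)
    have "1 - (1/2)^k \<le> (norm z)\<^sup>2" using k2 by (simp add: x_def)
    then have "sqrt (1 - (1/2)^k) \<le> norm z" by (simp add: real_le_lsqrt)
    then have zA: "z \<in> A k" using True by (simp add: A_def)
    have "x powr (- \<beta>) \<le> ((1/2)^(k+1)) powr (- \<beta>)"
      using k1 \<beta> by (intro powr_mono2') auto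
    also have "(1/2::real)^(k+1) = 2 powr (- (real k + 1))"
      unfolding one_half_power_eq_powr by (simp add: algebra_simps)
    also have "(2 powr (- (real k + 1))) powr (- \<beta>) = 2 powr (\<beta> * (real k + 1))"
      by (simp add: powr_powr algebra_simps)
    finally have "ennreal (x powr (- \<beta>)) * indicator \<bbbD> z \<le> ennreal (2 powr (\<beta> * (real k + 1))) * indicator (A k) z"
      using True zA by (simp add: ennreal_leI)
    also have "F k \<le> suminf F" for F :: "nat \<Rightarrow> ennreal"
      using sum_le_suminf[of F "{k}"] by simp
    finally show ?thesis by (simp add: x_def)
  qed auto
  have [measurable]: "A k \<in> sets borel" for k by (simp add: A_def)
  have "(\<integral>\<^sup>+z\<in>\<bbbD>. ennreal ((1 - (norm z)\<^sup>2) powr (- \<beta>)) \<partial>(lborel :: complex measure))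
      \<le> (\<integral>\<^sup>+z. (\<Sum>k. ennreal (2 powr (\<beta> * (real k + 1))) * indicator (A k) z) \<partial>lborel)"
    by (intro nn_integral_mono pw)
  also have "\<dots> = (\<Sum>k. ennreal (2 powr (\<beta> * (real k + 1))) * emeasure lborel (A k))"
    by (subst nn_integral_suminf) (auto simp: nn_integral_cmult)
  also have "\<dots> = (\<Sum>k. ennreal (2 powr \<beta> * pi * (2 powr (\<beta> - 1)) ^ k))"
  proof (intro suminf_cong)
    fix k
    have "2 powr (\<beta> * (real k + 1)) * (1/2)^k = 2 powr \<beta> * (2 powr (\<beta> - 1)) ^ k"
      unfolding one_half_power_eq_powr
      by (simp add: powr_powr algebra_simps flip: powr_add powr_realpow)
    then show "ennreal (2 powr (\<beta> * (real k + 1))) * emeasure lborel (A k) = ennreal (2 powr \<beta> * pi * (2 powr (\<beta> - 1)) ^ k)"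
      by (simp add: emA mult_ac flip: ennreal_mult')
  qed
  also have "\<dots> < \<infinity>"
  proof -
    have "2 powr (\<beta> - 1) < (1::real)" using \<beta> by (simp add: powr_less_one)
    then have "summable (\<lambda>k. 2 powr \<beta> * pi * (2 powr (\<beta> - 1)) ^ k)"
      by (intro summable_mult summable_geometric) auto
    then show ?thesis by (subst suminf_ennreal_eq[OF _ summable_sums]) auto
  qed
  finally show ?thesis .
qed

lemma bounded_in_bergman_space:
  assumes hol: "f holomorphic_on \<bbbD>" and bound: "\<And>z. z \<in> \<bbbD> \<Longrightarrow> norm (f z) \<le> B"
    and p: "p \<ge> 0" and \<alpha>: "\<alpha> > -1"
  shows "f \<in> bergman_space p \<alpha>"
proof -
  define \<beta> where "\<beta> = max 0 (- \<alpha>)"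
  have \<beta>: "0 \<le> \<beta>" "\<beta> < 1" using \<alpha> by (auto simp: \<beta>_def)
  have [measurable]: "\<bbbD> \<in> sets borel" by simp
  have B: "B \<ge> 0" using order_trans[OF norm_ge_zero bound[of 0]] by simp
  have "set_integrable lborel \<bbbD> (\<lambda>z. norm (f z) powr p * (1 - (norm z)\<^sup>2) powr \<alpha>)"
    unfolding set_integrable_def
  proof (rule integrableI_bounded)
    show "(\<lambda>z. indicator \<bbbD> z *\<^sub>R (norm (f z) powr p * (1 - (norm z)\<^sup>2) powr \<alpha>)) \<in> borel_measurable lborel"
      using bergman_integrand_measurable[OF hol] by (simp add: set_borel_measurable_def)
    have "(\<integral>\<^sup>+z. ennreal (norm (indicator \<bbbD> z *\<^sub>R (norm (f z) powr p * (1 - (norm z)\<^sup>2) powr \<alpha>))) \<partial>lborel)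
        \<le> (\<integral>\<^sup>+z. ennreal (B powr p) * (ennreal ((1 - (norm z)\<^sup>2) powr (- \<beta>)) * indicator \<bbbD> z) \<partial>lborel)"
    proof (rule nn_integral_mono)
      fix z :: complex
      show "ennreal (norm (indicator \<bbbD> z *\<^sub>R (norm (f z) powr p * (1 - (norm z)\<^sup>2) powr \<alpha>)))
        \<le> ennreal (B powr p) * (ennreal ((1 - (norm z)\<^sup>2) powr (- \<beta>)) * indicator \<bbbD> z)"
      proof (cases "z \<in> \<bbbD>")
        case True
        then have "(norm z)\<^sup>2 < 1" by (simp add: power_less_one_iff abs_square_less_1)
        then have "(1 - (norm z)\<^sup>2) powr \<alpha> \<le> (1 - (norm z)\<^sup>2) powr (- \<beta>)"
          by (intro powr_mono') (auto simp: \<beta>_def)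
        moreover have "norm (f z) powr p \<le> B powr p"
          using bound[OF True] p by (intro powr_mono2) auto
        ultimately have "norm (f z) powr p * (1 - (norm z)\<^sup>2) powr \<alpha> \<le> B powr p * (1 - (norm z)\<^sup>2) powr (- \<beta>)"
          by (intro mult_mono) auto
        then show ?thesis using True by (simp add: ennreal_leI flip: ennreal_mult')
      qed auto
    qed
    also have "\<dots> = ennreal (B powr p) * (\<integral>\<^sup>+z\<in>\<bbbD>. ennreal ((1 - (norm z)\<^sup>2) powr (- \<beta>)) \<partial>lborel)"
      by (rule nn_integral_cmult) measurable
    also have "\<dots> < \<infinity>"
      using nn_integral_disc_weight_finite[OF \<beta>] by (simp add: ennreal_mult_less_top)
    finally show "(\<integral>\<^sup>+z. ennreal (norm (indicator \<bbbD> z *\<^sub>R (norm (f z) powr p * (1 - (norm z)\<^sup>2) powr \<alpha>))) \<partial>lborel) < \<infinity>" .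
  qed
  with hol show ?thesis by (simp add: bergman_space_def)
qed

lemma bergman_space_cong:
  assumes "\<And>z. z \<in> \<bbbD> \<Longrightarrow> f z = g z"
  shows "f \<in> bergman_space p \<alpha> \<longleftrightarrow> g \<in> bergman_space p \<alpha>"
proof -
  have "set_integrable lborel \<bbbD> (\<lambda>z. norm (f z) powr p * (1 - (norm z)\<^sup>2) powr \<alpha>) \<longleftrightarrow>
      set_integrable lborel \<bbbD> (\<lambda>z. norm (g z) powr p * (1 - (norm z)\<^sup>2) powr \<alpha>)"
    by (rule set_integrable_cong) (auto simp: assms)
  moreover have "f holomorphic_on \<bbbD> \<longleftrightarrow> g holomorphic_on \<bbbD>"
    by (rule holomorphic_cong) (auto simp: assms)
  ultimately show ?thesis by (simp add: bergman_space_def)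
qed

lemma bergman_norm_cong:
  assumes "\<And>z. z \<in> \<bbbD> \<Longrightarrow> f z = g z"
  shows "bergman_norm p \<alpha> f = bergman_norm p \<alpha> g"
proof -
  have "(LINT z:\<bbbD>|lborel. norm (f z) powr p * (1 - (norm z)\<^sup>2) powr \<alpha>) =
      (LINT z:\<bbbD>|lborel. norm (g z) powr p * (1 - (norm z)\<^sup>2) powr \<alpha>)"
    by (rule set_lebesgue_integral_cong) (auto simp: assms)
  then show ?thesis by (simp add: bergman_norm_def)
qed

lemma bergman_space_cmult:
  assumes "f \<in> bergman_space p \<alpha>"
  shows "(\<lambda>z. c * f z) \<in> bergman_space p \<alpha>"
proof -
  have "set_integrable lborel \<bbbD> (\<lambda>z. norm c powr p * (norm (f z) powr p * (1 - (norm z)\<^sup>2) powr \<alpha>))"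
    using assms by (intro set_integrable_mult_right) (auto simp: bergman_space_def)
  then show ?thesis using assms
    by (auto simp: bergman_space_def norm_mult powr_mult mult.assoc intro: holomorphic_intros)
qed

lemma bergman_norm_cmult:
  assumes "p > 0"
  shows "bergman_norm p \<alpha> (\<lambda>z. c * f z) = norm c * bergman_norm p \<alpha> f"
proof -
  have "(LINT z:\<bbbD>|lborel. norm (c * f z) powr p * (1 - (norm z)\<^sup>2) powr \<alpha>)
      = (LINT z:\<bbbD>|lborel. norm c powr p * (norm (f z) powr p * (1 - (norm z)\<^sup>2) powr \<alpha>))"
    by (simp add: norm_mult powr_mult mult.assoc)
  also have "\<dots> = norm c powr p * (LINT z:\<bbbD>|lborel. norm (f z) powr p * (1 - (norm z)\<^sup>2) powr \<alpha>)"
    by (rule set_integral_mult_right)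
  finally have "bergman_norm p \<alpha> (\<lambda>z. c * f z) powr p = (norm c * bergman_norm p \<alpha> f) powr p"
    using assms by (simp add: bergman_norm_powr powr_mult bergman_norm_nonneg)
  then have "(bergman_norm p \<alpha> (\<lambda>z. c * f z) powr p) powr (1/p) = ((norm c * bergman_norm p \<alpha> f) powr p) powr (1/p)"
    by simp
  then show ?thesis using assms by (simp add: powr_powr bergman_norm_nonneg)
qed

text \<open>By the functional equation of \<open>h\<close>, composition with \<open>\<phi> t\<close> multiplies \<open>exp (\<mu> h)\<close> by the scalar
  \<open>exp (\<mu> t)\<close>. Norm convergence of the difference quotients is therefore convergence of scalars.\<close>

lemma exp_koenigs_eigenvector:
  assumes h: "koenigs_function \<phi> h" and p: "p > 0"
    and mem: "(\<lambda>z. exp (\<mu> * h z)) \<in> bergman_space p \<alpha>"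
  shows "\<mu> \<in> generator_point_spectrum p \<alpha> \<phi>"
proof -
  define f where "f z = exp (\<mu> * h z)" for z
  define c where "c t = (exp (\<mu> * of_real t) - 1) / of_real t" for t :: real
  have f: "f \<in> bergman_space p \<alpha>" using mem by (simp add: f_def[abs_def])
  have quot: "(composition_semigroup \<phi> t f z - f z) / of_real t = c t * f z" if "t > 0" "z \<in> \<bbbD>" for t z
    using h that by (simp add: composition_semigroup_def f_def c_def koenigs_function_def distrib_left exp_add field_simps)
  have "((\<lambda>w. exp (\<mu> * w)) has_field_derivative \<mu>) (at 0)"
    by (auto intro!: derivative_eq_intros)
  then have "((\<lambda>w. (exp (\<mu> * w) - 1) / w) \<longlongrightarrow> \<mu>) (at 0)"
    by (simp add: has_field_derivative_iff)
  moreover have "filterlim complex_of_real (at 0) (at_right 0)"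
    by (auto simp: filterlim_at eventually_at_filter intro!: tendsto_eq_intros)
  ultimately have c: "(c \<longlongrightarrow> \<mu>) (at_right 0)"
    unfolding c_def by (rule filterlim_compose)
  have pos: "\<forall>\<^sub>F t in at_right 0. t > (0::real)"
    by (simp add: eventually_at_right_less)
  have "bergman_tendsto p \<alpha> (\<lambda>t z. (composition_semigroup \<phi> t f z - f z) / of_real t) (\<lambda>z. \<mu> * f z) (at_right 0)"
    unfolding bergman_tendsto_def
  proof (intro conjI)
    show "(\<lambda>z. \<mu> * f z) \<in> bergman_space p \<alpha>" by (rule bergman_space_cmult[OF f])
    show "\<forall>\<^sub>F t in at_right 0. (\<lambda>z. (composition_semigroup \<phi> t f z - f z) / of_real t) \<in> bergman_space p \<alpha>"
      using pos
    proof eventually_elim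
      case (elim t)
      then have "(\<lambda>z. (composition_semigroup \<phi> t f z - f z) / of_real t) \<in> bergman_space p \<alpha>
          \<longleftrightarrow> (\<lambda>z. c t * f z) \<in> bergman_space p \<alpha>"
        by (intro bergman_space_cong quot)
      then show ?case using bergman_space_cmult[OF f] by blast
    qed
    have "\<forall>\<^sub>F t in at_right 0. bergman_norm p \<alpha> (\<lambda>z. (composition_semigroup \<phi> t f z - f z) / of_real t - \<mu> * f z)
        = norm (c t - \<mu>) * bergman_norm p \<alpha> f"
      using pos
    proof eventually_elim
      case (elim t)
      have "bergman_norm p \<alpha> (\<lambda>z. (composition_semigroup \<phi> t f z - f z) / of_real t - \<mu> * f z)
          = bergman_norm p \<alpha> (\<lambda>z. (c t - \<mu>) * f z)"
        using elim by (intro bergman_norm_cong) (simp add: quot left_diff_distrib)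
      then show ?case using p by (simp add: bergman_norm_cmult)
    qed
    moreover have "((\<lambda>t. norm (c t - \<mu>) * bergman_norm p \<alpha> f) \<longlongrightarrow> 0) (at_right 0)"
      using c by (intro tendsto_mult_left_zero tendsto_norm_zero) (simp add: LIM_zero_iff)
    ultimately show "((\<lambda>t. bergman_norm p \<alpha> (\<lambda>z. (composition_semigroup \<phi> t f z - f z) / of_real t - \<mu> * f z)) \<longlongrightarrow> 0) (at_right 0)"
      by (simp add: tendsto_cong)
  qed
  then have "bergman_generator p \<alpha> \<phi> f (\<lambda>z. \<mu> * f z)"
    using f by (simp add: bergman_generator_def)
  moreover have "f 0 \<noteq> 0" "(0::complex) \<in> \<bbbD>" by (auto simp: f_def)
  ultimately show ?thesis unfolding generator_point_spectrum_def by blast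
qed

section \<open>The boundary Schwarz lemma in the upper half-plane\<close>

abbreviation upper_half_plane :: "complex set" ("\<bbbH>")
  where "\<bbbH> \<equiv> {w. Im w > 0}"

lemma norm_diff_cnj_power2: "(norm (x - cnj y))\<^sup>2 = (norm (x - y))\<^sup>2 + 4 * Im x * Im y"
  by (simp add: cmod_power2) (simp add: power2_eq_square algebra_simps)

lemma half_plane_ne_cnj: "Im x > 0 \<Longrightarrow> Im y > 0 \<Longrightarrow> x \<noteq> cnj y"
  by auto

text \<open>The Schwarz lemma, applied to \<open>F\<close> between the Cayley transforms of the half-plane that send \<open>v\<close> and
  \<open>F v\<close> to \<open>0\<close>.\<close>

lemma schwarz_pick_half_plane:
  assumes hol: "F holomorphic_on \<bbbH>" and range: "F ` \<bbbH> \<subseteq> \<bbbH>" and v: "v \<in> \<bbbH>" and w: "w \<in> \<bbbH>"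
  shows "(norm (F w - F v))\<^sup>2 * (Im w * Im v) \<le> (norm (w - v))\<^sup>2 * (Im (F w) * Im (F v))"
proof -
  define \<psi> where "\<psi> \<zeta> = (v - cnj v * \<zeta>) / (1 - \<zeta>)" for \<zeta>
  define \<zeta>\<^sub>0 where "\<zeta>\<^sub>0 = (w - v) / (w - cnj v)"
  define m where "m \<zeta> = (F (\<psi> \<zeta>) - F v) / (F (\<psi> \<zeta>) - cnj (F v))" for \<zeta>
  have \<psi>_H: "\<psi> \<zeta> \<in> \<bbbH>" if "norm \<zeta> < 1" for \<zeta>
  proof -
    have "\<zeta> \<noteq> 1" using that by auto
    then have "Im (\<psi> \<zeta>) = Im v * (1 - (norm \<zeta>)\<^sup>2) / (norm (1 - \<zeta>))\<^sup>2"
      by (simp add: \<psi>_def Im_divide cmod_power2) (simp add: power2_eq_square algebra_simps)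
    moreover have "(norm \<zeta>)\<^sup>2 < 1" using that by (simp add: abs_square_less_1)
    ultimately show ?thesis using v \<open>\<zeta> \<noteq> 1\<close> by simp
  qed
  have F_H: "Im (F x) > 0" if "x \<in> \<bbbH>" for x using range that by blast
  have less: "norm (x - y) < norm (x - cnj y)" if "Im x > 0" "Im y > 0" for x y
    by (rule power2_less_imp_less) (use that in \<open>auto simp: norm_diff_cnj_power2\<close>)
  have "norm (m \<zeta>\<^sub>0) \<le> norm \<zeta>\<^sub>0"
  proof (rule Schwarz_Lemma(1))
    have "\<psi> holomorphic_on ball 0 1"
      unfolding \<psi>_def by (intro holomorphic_intros) auto
    then have "(\<lambda>\<zeta>. F (\<psi> \<zeta>)) holomorphic_on ball 0 1"
      by (rule holomorphic_on_compose_gen[OF _ hol, unfolded o_def]) (use \<psi>_H in auto)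
    moreover have "F (\<psi> \<zeta>) - cnj (F v) \<noteq> 0" if "\<zeta> \<in> ball 0 1" for \<zeta>
      using half_plane_ne_cnj[OF F_H F_H, of "\<psi> \<zeta>" v] \<psi>_H that v by auto
    ultimately show "m holomorphic_on ball 0 1"
      unfolding m_def by (intro holomorphic_intros) auto
    show "m 0 = 0" by (simp add: m_def \<psi>_def)
    show "norm (m \<zeta>) < 1" if "norm \<zeta> < 1" for \<zeta>
    proof -
      have "norm (F (\<psi> \<zeta>) - F v) < norm (F (\<psi> \<zeta>) - cnj (F v))"
        using less F_H \<psi>_H that v by blast
      then show ?thesis by (simp add: m_def norm_divide divide_less_eq)
    qed
    show "norm \<zeta>\<^sub>0 < 1"
      using less[of w v] v w by (simp add: \<zeta>\<^sub>0_def norm_divide divide_less_eq)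
  qed
  moreover have "\<psi> \<zeta>\<^sub>0 = w"
  proof -
    have "w - cnj v \<noteq> 0" "v - cnj v \<noteq> 0" using half_plane_ne_cnj v w by auto
    then have "1 - \<zeta>\<^sub>0 = (v - cnj v) / (w - cnj v)" "v - cnj v * \<zeta>\<^sub>0 = w * (v - cnj v) / (w - cnj v)"
      by (simp_all add: \<zeta>\<^sub>0_def field_simps)
    then show ?thesis using \<open>w - cnj v \<noteq> 0\<close> \<open>v - cnj v \<noteq> 0\<close> by (simp add: \<psi>_def)
  qed
  ultimately have le: "norm (F w - F v) / norm (F w - cnj (F v)) \<le> norm (w - v) / norm (w - cnj v)"
    by (simp add: m_def \<zeta>\<^sub>0_def norm_divide)
  have pos: "norm (F w - cnj (F v)) > 0" "norm (w - cnj v) > 0"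
    using half_plane_ne_cnj[OF F_H F_H, OF w v] half_plane_ne_cnj[of w v] v w by auto
  from le have "norm (F w - F v) * norm (w - cnj v) \<le> norm (w - v) * norm (F w - cnj (F v))"
    using pos by (simp add: divide_le_eq le_divide_eq mult.commute)
  then have "(norm (F w - F v) * norm (w - cnj v))\<^sup>2 \<le> (norm (w - v) * norm (F w - cnj (F v)))\<^sup>2"
    by (rule power_mono) auto
  then show ?thesis by (simp add: power_mult_distrib norm_diff_cnj_power2 algebra_simps)
qed

text \<open>The limit case is wanted for \<open>F w - c w\<close> with the largest possible \<open>c\<close>, whose imaginary part need
  not be positive.\<close>

lemma schwarz_pick_closed_half_plane:
  assumes hol: "F holomorphic_on \<bbbH>" and range: "\<And>w. w \<in> \<bbbH> \<Longrightarrow> Im (F w) \<ge> 0" and v: "v \<in> \<bbbH>" and w: "w \<in> \<bbbH>"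
  shows "(norm (F w - F v))\<^sup>2 * (Im w * Im v) \<le> (norm (w - v))\<^sup>2 * (Im (F w) * Im (F v))"
proof (rule tendsto_lowerbound)
  show "((\<lambda>\<epsilon>. (norm (w - v))\<^sup>2 * ((Im (F w) + \<epsilon>) * (Im (F v) + \<epsilon>)))
      \<longlongrightarrow> (norm (w - v))\<^sup>2 * (Im (F w) * Im (F v))) (at_right 0)"
    by (auto intro!: tendsto_eq_intros)
  show "\<forall>\<^sub>F \<epsilon> in at_right 0. (norm (F w - F v))\<^sup>2 * (Im w * Im v)
      \<le> (norm (w - v))\<^sup>2 * ((Im (F w) + \<epsilon>) * (Im (F v) + \<epsilon>))"
    using eventually_at_right_less[of 0]
  proof eventually_elim
    case (elim \<epsilon>)
    have "(\<lambda>w. F w + \<i> * of_real \<epsilon>) holomorphic_on \<bbbH>" by (intro holomorphic_intros hol)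
    moreover have "(\<lambda>w. F w + \<i> * of_real \<epsilon>) ` \<bbbH> \<subseteq> \<bbbH>"
      using elim range by (auto simp: add_nonneg_pos)
    ultimately show ?case
      using schwarz_pick_half_plane[of "\<lambda>w. F w + \<i> * of_real \<epsilon>" v w] v w by simp
  qed
qed auto

lemma frequently_Suc_le:
  fixes \<rho> :: "nat \<Rightarrow> real"
  assumes pos: "\<And>n. \<rho> n > 0" and lim: "\<rho> \<longlonglongrightarrow> 0"
  shows "\<exists>\<^sub>F n in sequentially. \<rho> (Suc n) \<le> \<rho> n"
proof (rule ccontr)
  assume "\<not> ?thesis"
  then obtain N where N: "\<And>n. n \<ge> N \<Longrightarrow> \<rho> n < \<rho> (Suc n)"
    by (auto simp: not_frequently eventually_sequentially not_le)
  have "\<rho> N \<le> \<rho> n" if "n \<ge> N" for n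
    using that by (induction n rule: dec_induct) (use N in \<open>auto intro: order_trans less_imp_le\<close>)
  then have "\<rho> N \<le> 0"
    by (intro tendsto_lowerbound[OF lim]) (auto simp: eventually_sequentially)
  with pos[of N] show False by simp
qed

text \<open>Schwarz-Pick compares \<open>\<Phi> w\<close> and \<open>a (n + 1)\<close> with \<open>w\<close> and \<open>a n\<close>. Since the orbit tends to the boundary
  point \<open>\<infinity>\<close>, its distance to the boundary, measured by \<open>\<rho>\<close>, fails to increase for infinitely many
  \<open>n\<close>; for these \<open>n\<close> the inequality becomes the claim in the limit.\<close>

lemma julia_wolff_half_plane:
  assumes hol: "\<Phi> holomorphic_on \<bbbH>" and range: "\<Phi> ` \<bbbH> \<subseteq> \<bbbH>"
    and orbit: "\<And>n. a n \<in> \<bbbH>" "\<And>n. a (Suc n) = \<Phi> (a n)" and inf: "filterlim a at_infinity sequentially"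
    and w: "w \<in> \<bbbH>"
  shows "Im w \<le> Im (\<Phi> w)"
proof (rule ccontr)
  assume "\<not> ?thesis"
  then have less: "Im (\<Phi> w) < Im w" by simp
  \<comment> \<open>\<open>\<rho> n\<close> is the imaginary part of \<open>- 1 / a n\<close>\<close>
  define \<rho> where "\<rho> n = Im (a n) / (norm (a n))\<^sup>2" for n
  have a0: "a n \<noteq> 0" for n using orbit(1)[of n] by auto
  have \<rho>_pos: "\<rho> n > 0" for n using orbit(1)[of n] a0 by (simp add: \<rho>_def)
  have inv: "(\<lambda>n. inverse (a n)) \<longlonglongrightarrow> 0"
    by (rule filterlim_compose[OF tendsto_inverse_0 inf])
  have \<rho>_lim: "\<rho> \<longlonglongrightarrow> 0"
  proof (rule Lim_null_comparison)
    show "\<forall>\<^sub>F n in sequentially. norm (\<rho> n) \<le> norm (inverse (a n))"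
    proof (intro always_eventually allI)
      fix n
      have "Im (a n) / (norm (a n))\<^sup>2 \<le> norm (a n) / (norm (a n))\<^sup>2"
        using abs_Im_le_cmod[of "a n"] by (intro divide_right_mono) auto
      also have "\<dots> = norm (inverse (a n))"
        using a0[of n] by (simp add: norm_inverse power2_eq_square) (simp add: inverse_eq_divide norm_divide)
      finally show "norm (\<rho> n) \<le> norm (inverse (a n))"
        using \<rho>_pos[of n] by (simp add: \<rho>_def)
    qed
    show "(\<lambda>n. norm (inverse (a n))) \<longlonglongrightarrow> 0" using inv by (rule tendsto_norm_zero)
  qed
  define A where "A n = (norm (\<Phi> w * cnj (inverse (a (Suc n))) - 1))\<^sup>2 * Im w" for n
  define B where "B n = (norm (w * cnj (inverse (a n)) - 1))\<^sup>2 * Im (\<Phi> w)" for n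
  have cnj_inv: "(\<lambda>n. cnj (inverse (a n))) \<longlonglongrightarrow> 0"
    using tendsto_cnj[OF inv] by simp
  have "A \<longlonglongrightarrow> (norm (\<Phi> w * 0 - 1))\<^sup>2 * Im w"
    unfolding A_def by (intro tendsto_intros LIMSEQ_Suc[OF cnj_inv])
  moreover have "B \<longlonglongrightarrow> (norm (w * 0 - 1))\<^sup>2 * Im (\<Phi> w)"
    unfolding B_def by (intro tendsto_intros cnj_inv)
  ultimately have "(\<lambda>n. A n - B n) \<longlonglongrightarrow> Im w - Im (\<Phi> w)"
    by (auto dest: tendsto_diff)
  then have "\<forall>\<^sub>F n in sequentially. 0 < A n - B n"
    by (rule order_tendstoD) (use less in simp)
  with frequently_Suc_le[OF \<rho>_pos \<rho>_lim]
  have "\<exists>\<^sub>F n in sequentially. \<rho> (Suc n) \<le> \<rho> n \<and> 0 < A n - B n"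
    by (rule frequently_eventually_frequently)
  then obtain n where n: "\<rho> (Suc n) \<le> \<rho> n" "B n < A n"
    by (auto dest: frequently_ex)
  have dist_cnj: "(norm (x * cnj (inverse b) - 1))\<^sup>2 = (norm (x - cnj b))\<^sup>2 / (norm b)\<^sup>2" if "b \<noteq> 0" for x b
  proof -
    have "x * cnj (inverse b) - 1 = (x - cnj b) / cnj b" using that by (simp add: field_simps)
    then show ?thesis by (simp add: norm_divide power_divide)
  qed
  have "(norm (\<Phi> w - cnj (a (Suc n))))\<^sup>2 * (Im w * Im (a n))
      \<le> (norm (w - cnj (a n)))\<^sup>2 * (Im (\<Phi> w) * Im (a (Suc n)))"
    using schwarz_pick_half_plane[OF hol range orbit(1)[of n] w]
    by (simp add: norm_diff_cnj_power2 orbit(2) algebra_simps)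
  then have "(norm (\<Phi> w - cnj (a (Suc n))))\<^sup>2 * (Im w * Im (a n)) / ((norm (a n))\<^sup>2 * (norm (a (Suc n)))\<^sup>2)
      \<le> (norm (w - cnj (a n)))\<^sup>2 * (Im (\<Phi> w) * Im (a (Suc n))) / ((norm (a n))\<^sup>2 * (norm (a (Suc n)))\<^sup>2)"
    by (rule divide_right_mono) simp
  then have "A n * \<rho> n \<le> B n * \<rho> (Suc n)"
    unfolding A_def B_def \<rho>_def dist_cnj[OF a0] by (simp add: mult_ac)
  also have "\<dots> \<le> B n * \<rho> n"
  proof (rule mult_left_mono[OF n(1)])
    have "Im (\<Phi> w) > 0" using range w by blast
    then show "B n \<ge> 0" by (simp add: B_def)
  qed
  finally show False using n(2) \<rho>_pos[of n] by simp
qed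

text \<open>Schwarz-Pick relative to a point \<open>v\<close> where \<open>Im q\<close> is tiny compared with \<open>Im v\<close> gives, with
  \<open>X = |q w - q v|\<close>, a quadratic inequality \<open>X\<^sup>2 \<le> \<epsilon> s (X + O(1)) / 4\<close> on the ray, whence \<open>X\<close> is at most
  of the order \<open>\<epsilon> s\<close>.\<close>

lemma half_plane_ray_limit_zero:
  assumes hol: "q holomorphic_on \<bbbH>" and range: "\<And>w. w \<in> \<bbbH> \<Longrightarrow> Im (q w) \<ge> 0"
    and small: "\<And>\<eta>. \<eta> > 0 \<Longrightarrow> \<exists>w\<in>\<bbbH>. Im (q w) \<le> \<eta> * Im w"
    and e: "norm e = 1" "Im e > 0"
  shows "((\<lambda>s. q (of_real s * e) / of_real s) \<longlongrightarrow> 0) at_top"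
proof (rule tendstoI)
  fix \<epsilon> :: real assume \<epsilon>: "\<epsilon> > 0"
  define \<sigma> where "\<sigma> = Im e"
  define \<eta> where "\<eta> = \<epsilon> * \<sigma> / 16"
  have \<eta>: "\<eta> > 0" using \<epsilon> e by (simp add: \<eta>_def \<sigma>_def)
  obtain v where v: "v \<in> \<bbbH>" "Im (q v) \<le> \<eta> * Im v" using small[OF \<eta>] by blast
  define Q where "Q = norm (q v)"
  show "\<forall>\<^sub>F s in at_top. dist (q (of_real s * e) / of_real s) 0 < \<epsilon>"
    using eventually_ge_at_top[of "norm v"] eventually_gt_at_top[of 0] eventually_gt_at_top[of "4 * Q / \<epsilon>"]
  proof eventually_elim
    case (elim s)
    define w where "w = of_real s * e"
    define X where "X = norm (q w - q v)"
    have s: "s > 0" by (rule elim)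
    have Im_w: "Im w = s * \<sigma>" by (simp add: w_def \<sigma>_def)
    have w: "w \<in> \<bbbH>" using s e by (simp add: Im_w \<sigma>_def)
    have "norm w = s" using s e by (simp add: w_def norm_mult)
    then have "norm (w - v) \<le> 2 * s"
      using norm_triangle_ineq4[of w v] elim by simp
    then have d: "(norm (w - v))\<^sup>2 \<le> (2 * s)\<^sup>2" by (rule power_mono) simp
    have qw: "Im (q w) \<le> X + Q"
      using abs_Im_le_cmod[of "q w"] norm_triangle_ineq[of "q w - q v" "q v"] by (simp add: X_def Q_def)
    have "X\<^sup>2 * (Im w * Im v) \<le> (norm (w - v))\<^sup>2 * (Im (q w) * Im (q v))"
      unfolding X_def by (rule schwarz_pick_closed_half_plane[OF hol range v(1) w])
    also have "\<dots> \<le> (2 * s)\<^sup>2 * ((X + Q) * (\<eta> * Im v))"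
      using d qw v range[OF w] range[OF v(1)] by (intro mult_mono) auto
    finally have "(X\<^sup>2 * \<sigma>) * (s * Im v) \<le> (4 * s * \<eta> * (X + Q)) * (s * Im v)"
      by (simp add: Im_w power2_eq_square mult_ac)
    then have "X\<^sup>2 * \<sigma> \<le> 4 * s * \<eta> * (X + Q)"
      by (rule mult_right_le_imp_le) (use s v in simp)
    then have "X\<^sup>2 * \<sigma> \<le> (\<epsilon> / 4 * s * (X + Q)) * \<sigma>"
      by (simp add: \<eta>_def mult_ac)
    then have quad: "X\<^sup>2 \<le> \<epsilon> / 4 * s * (X + Q)" using e by (simp add: \<sigma>_def)
    have X: "X \<le> max Q (\<epsilon> / 2 * s)"
    proof (cases "X \<le> Q")
      case False
      then have "X > 0" using norm_ge_zero[of "q v"] unfolding Q_def by linarith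
      have "X * X \<le> \<epsilon> / 4 * s * (X + X)"
        using quad False \<epsilon> s by (intro order_trans[OF quad[unfolded power2_eq_square]] mult_left_mono) auto
      also have "\<dots> = X * (\<epsilon> / 2 * s)" by simp
      finally have "X \<le> \<epsilon> / 2 * s" using \<open>X > 0\<close> by (simp only: mult_le_cancel_left_pos)
      then show ?thesis by simp
    qed simp
    have "4 * Q < \<epsilon> * s" using elim(3) \<epsilon> by (simp add: divide_less_eq mult.commute)
    moreover have "norm (q w) \<le> X + Q"
      using norm_triangle_ineq[of "q w - q v" "q v"] by (simp add: X_def Q_def)
    moreover have "\<epsilon> * s > 0" using \<epsilon> s by simp
    ultimately have "norm (q w) < \<epsilon> * s" using X by (auto simp: max_def split: if_splits)
    then show ?case using s by (simp add: w_def norm_divide divide_less_eq)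
  qed
qed

text \<open>With \<open>c\<close> the infimum of \<open>Im F / Im\<close>, the function \<open>F w - c w\<close> still has nonnegative imaginary part,
  and it is negligible along rays by the previous lemma.\<close>

lemma julia_caratheodory_half_plane:
  assumes hol: "F holomorphic_on \<bbbH>" and range: "F ` \<bbbH> \<subseteq> \<bbbH>"
  obtains c :: real where
    "\<And>e. norm e = 1 \<Longrightarrow> Im e > 0 \<Longrightarrow> ((\<lambda>s. F (of_real s * e) / of_real s) \<longlongrightarrow> of_real c * e) at_top"
proof -
  define R where "R = (\<lambda>w. Im (F w) / Im w) ` \<bbbH>"
  define c where "c = Inf R"
  have F: "Im (F w) > 0" if "w \<in> \<bbbH>" for w using range that by blast
  have bdd: "bdd_below R" unfolding R_def
    by (rule bdd_belowI2[of _ 0]) (use F in \<open>auto intro: less_imp_le\<close>)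
  have "\<i> \<in> \<bbbH>" by simp
  then have ne: "R \<noteq> {}" unfolding R_def by blast
  define q where "q w = F w - of_real c * w" for w
  have q_hol: "q holomorphic_on \<bbbH>" unfolding q_def by (intro holomorphic_intros hol)
  have q_range: "Im (q w) \<ge> 0" if w: "w \<in> \<bbbH>" for w
  proof -
    have "c \<le> Im (F w) / Im w" unfolding c_def by (rule cInf_lower[OF _ bdd]) (use w in \<open>auto simp: R_def\<close>)
    then show ?thesis using w by (simp add: q_def le_divide_eq)
  qed
  have q_small: "\<exists>w\<in>\<bbbH>. Im (q w) \<le> \<eta> * Im w" if \<eta>: "\<eta> > 0" for \<eta>
  proof -
    obtain y where "y \<in> R" "y < c + \<eta>"
      using cInf_lessD[OF ne, of "c + \<eta>"] \<eta> by (auto simp: c_def)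
    then obtain w where w: "w \<in> \<bbbH>" "Im (F w) / Im w < c + \<eta>" by (auto simp: R_def)
    then have "Im (q w) \<le> \<eta> * Im w" by (simp add: q_def divide_less_eq algebra_simps)
    with w show ?thesis by blast
  qed
  show thesis
  proof
    fix e :: complex assume e: "norm e = 1" "Im e > 0"
    have "((\<lambda>s. q (of_real s * e) / of_real s + of_real c * e) \<longlongrightarrow> 0 + of_real c * e) at_top"
      by (intro tendsto_add tendsto_const half_plane_ray_limit_zero q_hol q_range q_small e)
    moreover have "\<forall>\<^sub>F s in at_top. q (of_real s * e) / of_real s + of_real c * e = F (of_real s * e) / of_real s"
      using eventually_gt_at_top[of 0] by eventually_elim (simp add: q_def field_simps)
    ultimately show "((\<lambda>s. F (of_real s * e) / of_real s) \<longlongrightarrow> of_real c * e) at_top"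
      by (simp add: tendsto_cong)
  qed
qed

section \<open>The Cayley transform at the Denjoy-Wolff point\<close>

definition disk_to_half_plane :: "complex \<Rightarrow> complex \<Rightarrow> complex" where
  "disk_to_half_plane \<tau> z = \<i> * (\<tau> + z) / (\<tau> - z)"

definition half_plane_to_disk :: "complex \<Rightarrow> complex \<Rightarrow> complex" where
  "half_plane_to_disk \<tau> w = \<tau> * (w - \<i>) / (w + \<i>)"

lemma half_plane_ne: "w \<in> \<bbbH> \<Longrightarrow> w + \<i> \<noteq> 0"
  by (auto simp: complex_eq_iff)

context
  fixes \<tau> :: complex
  assumes \<tau>: "norm \<tau> = 1"
begin

lemma tau_ne: "z \<in> \<bbbD> \<Longrightarrow> \<tau> \<noteq> z" "\<tau> \<noteq> 0" using \<tau> by auto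

lemma Im_disk_to_half_plane:
  assumes "z \<in> \<bbbD>"
  shows "Im (disk_to_half_plane \<tau> z) = (1 - (norm z)\<^sup>2) / (norm (\<tau> - z))\<^sup>2"
proof -
  have "(Re \<tau>)\<^sup>2 + (Im \<tau>)\<^sup>2 = 1" using \<tau> by (simp add: cmod_def)
  then have "(Im \<tau>)\<^sup>2 = 1 - (Re \<tau>)\<^sup>2" by simp
  then have num: "Im (\<i> * (\<tau> + z)) * Re (\<tau> - z) - Re (\<i> * (\<tau> + z)) * Im (\<tau> - z) = 1 - (norm z)\<^sup>2"
    by (simp add: cmod_power2) (simp add: power2_eq_square algebra_simps)
  show ?thesis
    by (simp only: disk_to_half_plane_def Im_divide num cmod_power2[of "\<tau> - z"])
qed

lemma disk_to_half_plane_in: "z \<in> \<bbbD> \<Longrightarrow> disk_to_half_plane \<tau> z \<in> \<bbbH>"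
  using tau_ne(1)[of z] by (simp add: Im_disk_to_half_plane abs_square_less_1)

lemma one_minus_norm_half_plane_to_disk:
  assumes "w \<in> \<bbbH>"
  shows "1 - (norm (half_plane_to_disk \<tau> w))\<^sup>2 = 4 * Im w / (norm (w + \<i>))\<^sup>2"
proof -
  have eq: "(norm (w + \<i>))\<^sup>2 - (norm (w - \<i>))\<^sup>2 = 4 * Im w"
    using norm_diff_cnj_power2[of w \<i>] by simp
  have "norm (half_plane_to_disk \<tau> w) = norm (w - \<i>) / norm (w + \<i>)"
    using \<tau> by (simp add: half_plane_to_disk_def norm_divide norm_mult)
  then show ?thesis using half_plane_ne[OF assms]
    by (simp add: power_divide eq[symmetric] diff_divide_distrib)
qed

lemma half_plane_to_disk_in:
  assumes "w \<in> \<bbbH>"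
  shows "half_plane_to_disk \<tau> w \<in> \<bbbD>"
proof -
  have "1 - (norm (half_plane_to_disk \<tau> w))\<^sup>2 > 0"
    using assms half_plane_ne[OF assms] by (simp add: one_minus_norm_half_plane_to_disk)
  then show ?thesis by (simp add: abs_square_less_1)
qed

lemma half_plane_to_disk_inverse:
  assumes "z \<in> \<bbbD>"
  shows "half_plane_to_disk \<tau> (disk_to_half_plane \<tau> z) = z"
proof -
  have "\<tau> - z \<noteq> 0" using tau_ne(1)[OF assms] by simp
  then have "disk_to_half_plane \<tau> z - \<i> = \<i> * (2 * z) / (\<tau> - z)"
    "disk_to_half_plane \<tau> z + \<i> = \<i> * (2 * \<tau>) / (\<tau> - z)"
    by (simp_all add: disk_to_half_plane_def field_simps)
  then show ?thesis using \<open>\<tau> - z \<noteq> 0\<close> tau_ne(2) by (simp add: half_plane_to_disk_def)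
qed

lemma disk_to_half_plane_inverse:
  assumes "w \<in> \<bbbH>"
  shows "disk_to_half_plane \<tau> (half_plane_to_disk \<tau> w) = w"
proof -
  have w: "w + \<i> \<noteq> 0" using half_plane_ne[OF assms] .
  then have "\<tau> + half_plane_to_disk \<tau> w = \<tau> * (2 * w) / (w + \<i>)"
    "\<tau> - half_plane_to_disk \<tau> w = \<tau> * (2 * \<i>) / (w + \<i>)"
    by (simp_all add: half_plane_to_disk_def field_simps)
  then show ?thesis using w tau_ne(2) by (simp add: disk_to_half_plane_def)
qed

lemma holomorphic_disk_to_half_plane: "disk_to_half_plane \<tau> holomorphic_on \<bbbD>"
  unfolding disk_to_half_plane_def[abs_def] using tau_ne(1) by (intro holomorphic_intros) auto

lemma holomorphic_half_plane_to_disk: "half_plane_to_disk \<tau> holomorphic_on \<bbbH>"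
  unfolding half_plane_to_disk_def[abs_def] using half_plane_ne by (intro holomorphic_intros) auto

text \<open>The Cayley transform takes the horodisks at \<open>\<tau>\<close> to the half-planes \<open>Im w > k\<close> with \<open>k > 0\<close>.\<close>

lemma Im_disk_to_half_plane_le_outside_horodisk:
  assumes z: "z \<in> \<bbbD>" "z \<notin> horodisk \<tau> r" and r: "0 < r" "r < 1"
  shows "Im (disk_to_half_plane \<tau> z) \<le> (1 - r) / r"
proof -
  define d where "d = (norm (\<tau> - z))\<^sup>2"
  define R where "R = Re \<tau> * Re z + Im \<tau> * Im z"
  have \<tau>2: "(Re \<tau>)\<^sup>2 + (Im \<tau>)\<^sup>2 = 1" using \<tau> by (simp add: cmod_def)
  have d: "d = 1 - 2 * R + (norm z)\<^sup>2"
    using \<tau>2 by (simp add: d_def R_def cmod_power2) (simp add: power2_eq_square algebra_simps)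
  have "r \<le> norm (of_real (1 - r) * \<tau> - z)" using z by (simp add: horodisk_def dist_norm)
  then have "r\<^sup>2 \<le> (norm (of_real (1 - r) * \<tau> - z))\<^sup>2" using r by (intro power_mono) auto
  also have "\<dots> = (1 - r)\<^sup>2 * ((Re \<tau>)\<^sup>2 + (Im \<tau>)\<^sup>2) - 2 * (1 - r) * R + (norm z)\<^sup>2"
    by (simp add: R_def cmod_power2) (simp add: power2_eq_square algebra_simps)
  finally have "r * (1 - (norm z)\<^sup>2) \<le> (1 - r) * d"
    unfolding \<tau>2 d by (simp add: power2_eq_square algebra_simps)
  moreover have "d > 0" using tau_ne(1)[OF z(1)] by (simp add: d_def)
  ultimately show ?thesis
    using r z by (simp add: Im_disk_to_half_plane d_def[symmetric] field_simps)
qed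

end

section \<open>The generator in the Koenigs coordinate\<close>

lemma deriv_koenigs_nonzero:
  assumes "koenigs_function \<phi> h" "z \<in> \<bbbD>"
  shows "deriv h z \<noteq> 0"
  by (rule holomorphic_injective_imp_regular[of h \<bbbD>]) (use assms in \<open>auto simp: koenigs_function_def\<close>)

text \<open>Since \<open>h (\<phi> t z) - h z = t\<close>, the difference quotient in \<open>t\<close> is a ratio of two difference quotients
  along the orbit, one of \<open>F\<close> and one of \<open>h\<close>.\<close>

lemma flow_difference_quotient:
  assumes \<phi>: "disk_semigroup \<phi>" and h: "koenigs_function \<phi> h"
    and F: "F holomorphic_on \<bbbD>" and z: "z \<in> \<bbbD>"
  shows "((\<lambda>t. (F (\<phi> t z) - F z) / of_real t) \<longlongrightarrow> deriv F z / deriv h z) (at_right 0)"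
proof -
  have h_flow: "h (\<phi> t z) = h z + of_real t" if "t \<ge> 0" for t
    using h z that by (auto simp: koenigs_function_def)
  have h_hol: "h holomorphic_on \<bbbD>" using h by (simp add: koenigs_function_def)
  have nz: "deriv h z \<noteq> 0" by (rule deriv_koenigs_nonzero[OF h z])
  have pos: "\<forall>\<^sub>F t in at_right 0. t > (0::real)" by (simp add: eventually_at_right_less)
  have "compact {z} \<and> {z} \<subseteq> \<bbbD> \<longrightarrow> uniform_limit {z} \<phi> (\<lambda>z. z) (at_right 0)"
    using \<phi> unfolding disk_semigroup_def by blast
  then have "((\<lambda>t. \<phi> t z) \<longlongrightarrow> z) (at_right 0)" using z by simp
  moreover have "\<forall>\<^sub>F t in at_right 0. \<phi> t z \<noteq> z"
    using pos
  proof eventually_elim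
    case (elim t)
    then show ?case using h_flow[of t] by auto
  qed
  ultimately have lim: "filterlim (\<lambda>t. \<phi> t z) (at z) (at_right 0)"
    by (simp add: filterlim_at)
  have quot: "((\<lambda>t. (f (\<phi> t z) - f z) / (\<phi> t z - z)) \<longlongrightarrow> deriv f z) (at_right 0)"
    if "f holomorphic_on \<bbbD>" for f
  proof -
    have "(f has_field_derivative deriv f z) (at z)"
      using that z by (intro holomorphic_derivI[of f \<bbbD>]) auto
    then have "((\<lambda>y. (f y - f z) / (y - z)) \<longlongrightarrow> deriv f z) (at z)"
      by (simp add: has_field_derivative_iff)
    then show ?thesis using lim by (rule filterlim_compose)
  qed
  have "((\<lambda>t. ((F (\<phi> t z) - F z) / (\<phi> t z - z)) / ((h (\<phi> t z) - h z) / (\<phi> t z - z))) \<longlongrightarrow> deriv F z / deriv h z) (at_right 0)"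
    by (intro tendsto_divide quot F h_hol nz)
  moreover have "\<forall>\<^sub>F t in at_right 0.
      ((F (\<phi> t z) - F z) / (\<phi> t z - z)) / ((h (\<phi> t z) - h z) / (\<phi> t z - z)) = (F (\<phi> t z) - F z) / of_real t"
    using pos
  proof eventually_elim
    case (elim t)
    then have "\<phi> t z \<noteq> z" using h_flow[of t] by auto
    then show ?case using elim h_flow[of t] by simp
  qed
  ultimately show ?thesis by (rule Lim_transform_eventually)
qed

lemma exp_ode_solution:
  assumes f: "f holomorphic_on \<bbbD>" and h: "h holomorphic_on \<bbbD>"
    and ode: "\<And>z. z \<in> \<bbbD> \<Longrightarrow> deriv f z = \<mu> * f z * deriv h z"
  obtains c where "\<And>z. z \<in> \<bbbD> \<Longrightarrow> f z = c * exp (\<mu> * h z)"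
proof -
  have "\<exists>c. \<forall>z\<in>\<bbbD>. f z * exp (- \<mu> * h z) = c"
  proof (rule has_field_derivative_zero_constant)
    fix z :: complex assume z: "z \<in> \<bbbD>"
    have "(f has_field_derivative deriv f z) (at z)" "(h has_field_derivative deriv h z) (at z)"
      using f h z by (auto intro: holomorphic_derivI)
    then have "((\<lambda>z. f z * exp (- \<mu> * h z)) has_field_derivative
        deriv f z * exp (- \<mu> * h z) + (exp (- \<mu> * h z) * (- \<mu> * deriv h z)) * f z) (at z)"
      by (intro DERIV_mult DERIV_chain2[OF DERIV_exp DERIV_cmult])
    moreover have "deriv f z * exp (- \<mu> * h z) + (exp (- \<mu> * h z) * (- \<mu> * deriv h z)) * f z = 0"
      unfolding ode[OF z] by simp
    ultimately show "((\<lambda>z. f z * exp (- \<mu> * h z)) has_field_derivative 0) (at z within \<bbbD>)"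
      by (simp only: has_field_derivative_at_within)
  qed simp
  then obtain c where c: "\<And>z. z \<in> \<bbbD> \<Longrightarrow> f z * exp (- \<mu> * h z) = c" by blast
  show thesis
  proof
    fix z :: complex assume "z \<in> \<bbbD>"
    then show "f z = c * exp (\<mu> * h z)"
      using c[of z] by (auto simp: exp_minus field_simps)
  qed
qed

text \<open>The imaginary axis has no interior, so this is the open mapping theorem.\<close>

lemma constant_if_Re_zero:
  assumes f: "f holomorphic_on S" and S: "open S" "connected S" and re: "\<And>z. z \<in> S \<Longrightarrow> Re (f z) = 0"
  shows "f constant_on S"
proof (rule ccontr)
  assume nc: "\<not> f constant_on S"
  then have "S \<noteq> {}" by (auto simp: constant_on_def)
  then obtain z where z: "z \<in> S" by blast
  have "open (f ` S)" by (rule open_mapping_thm[OF f S S(1) subset_refl nc])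
  then obtain e where e: "e > 0" "ball (f z) e \<subseteq> f ` S" using z by (meson imageI open_contains_ball)
  have "f z + of_real (e / 2) \<in> ball (f z) e" using e by (simp add: dist_norm)
  then obtain y where "y \<in> S" "f y = f z + of_real (e / 2)" using e by (metis imageE subsetD)
  then have "Re (f y) = Re (f z) + e / 2" by simp
  then show False using re[OF \<open>y \<in> S\<close>] re[OF z] e by simp
qed

text \<open>The derivative of \<open>|G|\<^sup>2\<close> along the flow vanishes, which says that the logarithmic derivative
  \<open>L = G' / (h' G)\<close> is purely imaginary. It is holomorphic, hence a constant \<open>i \<kappa>\<close>.\<close>

lemma invariant_modulus_is_exp_koenigs:
  assumes \<phi>: "disk_semigroup \<phi>" and h: "koenigs_function \<phi> h"
    and G: "G holomorphic_on \<bbbD>" and nz: "\<And>z. z \<in> \<bbbD> \<Longrightarrow> G z \<noteq> 0"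
    and inv: "\<And>t z. t \<ge> 0 \<Longrightarrow> z \<in> \<bbbD> \<Longrightarrow> norm (G (\<phi> t z)) = norm (G z)"
  obtains c and \<kappa> :: real where "\<And>z. z \<in> \<bbbD> \<Longrightarrow> G z = c * exp (\<i> * of_real \<kappa> * h z)"
proof -
  have h_hol: "h holomorphic_on \<bbbD>" using h by (simp add: koenigs_function_def)
  define L where "L z = deriv G z / deriv h z / G z" for z
  have L_hol: "L holomorphic_on \<bbbD>"
    unfolding L_def using nz deriv_koenigs_nonzero[OF h]
    by (intro holomorphic_intros holomorphic_deriv G h_hol) auto
  have Re_L: "Re (L z) = 0" if z: "z \<in> \<bbbD>" for z
  proof -
    define D where "D t = (G (\<phi> t z) - G z) / of_real t" for t :: real
    define d where "d = deriv G z / deriv h z"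
    have D: "(D \<longlongrightarrow> d) (at_right 0)"
      unfolding D_def d_def by (rule flow_difference_quotient[OF \<phi> h G z])
    \<comment> \<open>the expansion of \<open>(|G z + t D t|\<^sup>2 - |G z|\<^sup>2) / t\<close>, which is \<open>0\<close> by invariance\<close>
    have "((\<lambda>t. 2 * Re (cnj (G z) * D t) + t * (norm (D t))\<^sup>2) \<longlongrightarrow> 2 * Re (cnj (G z) * d) + 0 * (norm d)\<^sup>2) (at_right 0)"
      by (intro tendsto_intros D)
    moreover have "\<forall>\<^sub>F t in at_right 0. 2 * Re (cnj (G z) * D t) + t * (norm (D t))\<^sup>2 = 0"
      using eventually_at_right_less[of 0]
    proof eventually_elim
      case (elim t)
      then have "G (\<phi> t z) = G z + of_real t * D t" by (simp add: D_def)
      then have "(norm (G z + of_real t * D t))\<^sup>2 = (norm (G z))\<^sup>2" using inv[of t z] z elim by simp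
      moreover have "(norm (G z + of_real t * D t))\<^sup>2
          = (norm (G z))\<^sup>2 + t * (2 * Re (cnj (G z) * D t) + t * (norm (D t))\<^sup>2)"
        by (simp add: cmod_power2) (simp add: power2_eq_square algebra_simps)
      ultimately have "t * (2 * Re (cnj (G z) * D t) + t * (norm (D t))\<^sup>2) = 0" by linarith
      then show ?case using elim by simp
    qed
    ultimately have "((\<lambda>t. 0) \<longlongrightarrow> 2 * Re (cnj (G z) * d) + 0 * (norm d)\<^sup>2) (at_right (0::real))"
      by (rule Lim_transform_eventually)
    then have "0 = 2 * Re (cnj (G z) * d) + 0 * (norm d)\<^sup>2"
      by (simp only: tendsto_const_iff trivial_limit_at_right_real not_False_eq_True)
    then have "Re (cnj (G z) * d) = 0" by simp
    moreover have "of_real ((norm (G z))\<^sup>2) = G z * cnj (G z)"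
      by (rule complex_norm_square)
    then have "d / G z = (cnj (G z) * d) / of_real ((norm (G z))\<^sup>2)"
      using nz[OF z] by simp
    ultimately show ?thesis by (simp only: L_def d_def Re_divide_of_real div_0)
  qed
  have "L constant_on \<bbbD>" by (rule constant_if_Re_zero[OF L_hol]) (use Re_L in auto)
  then obtain l where l: "\<And>z. z \<in> \<bbbD> \<Longrightarrow> L z = l" by (auto simp: constant_on_def)
  have "l = \<i> * of_real (Im l)" using Re_L[of 0] l[of 0] by (simp add: complex_eq_iff)
  moreover have "deriv G z = l * G z * deriv h z" if "z \<in> \<bbbD>" for z
    using l[OF that] nz[OF that] deriv_koenigs_nonzero[OF h that] by (simp add: L_def field_simps)
  ultimately show thesis
    using exp_ode_solution[OF G h_hol] that by metis
qed

section \<open>Semigroups of finite shift\<close>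

text \<open>The iterates of \<open>\<phi> t\<close> at \<open>0\<close> tend to \<open>\<tau>\<close>. In the half-plane they form an orbit that tends to \<open>\<infinity>\<close>, as
  the lemma of Julia and Wolff requires.\<close>

lemma im_half_plane_flow_mono:
  assumes \<phi>: "disk_semigroup \<phi>" and dw: "denjoy_wolff_point \<phi> \<tau>" and t: "t \<ge> 0" and z: "z \<in> \<bbbD>"
  shows "Im (disk_to_half_plane \<tau> z) \<le> Im (disk_to_half_plane \<tau> (\<phi> t z))"
proof (cases "t = 0")
  case True
  then show ?thesis using \<phi> z by (simp add: disk_semigroup_def)
next
  case False
  with t have t: "t > 0" by simp
  have \<tau>: "norm \<tau> = 1" using dw by (simp add: denjoy_wolff_point_def)
  have \<phi>_hol: "\<phi> s holomorphic_on \<bbbD>" and \<phi>_D: "\<phi> s ` \<bbbD> \<subseteq> \<bbbD>" if "s \<ge> 0" for s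
    using \<phi> that by (auto simp: disk_semigroup_def)
  have \<phi>_add: "\<phi> (t + s) 0 = \<phi> t (\<phi> s 0)" if "s \<ge> 0" for s
    using \<phi> that t by (simp add: disk_semigroup_def)
  let ?W = "disk_to_half_plane \<tau>" and ?C = "half_plane_to_disk \<tau>"
  define \<Phi> where "\<Phi> w = ?W (\<phi> t (?C w))" for w
  define a where "a n = ?W (\<phi> (real n * t) 0)" for n
  have C_D: "?C w \<in> \<bbbD>" if "w \<in> \<bbbH>" for w using half_plane_to_disk_in[OF \<tau> that] .
  have \<phi>0_D: "\<phi> (real n * t) 0 \<in> \<bbbD>" for n
  proof -
    have "(0::complex) \<in> \<bbbD>" "real n * t \<ge> 0" using t by auto
    then show ?thesis using \<phi>_D by blast
  qed
  have tC_D: "\<phi> t (?C w) \<in> \<bbbD>" if "w \<in> \<bbbH>" for w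
    using \<phi>_D[of t] t C_D[OF that] by (meson image_subset_iff less_imp_le)
  have "(\<lambda>w. \<phi> t (?C w)) holomorphic_on \<bbbH>"
    by (rule holomorphic_on_compose_gen[OF holomorphic_half_plane_to_disk[OF \<tau>] \<phi>_hol, unfolded o_def])
      (use t C_D in auto)
  then have "\<Phi> holomorphic_on \<bbbH>" unfolding \<Phi>_def
    by (rule holomorphic_on_compose_gen[OF _ holomorphic_disk_to_half_plane[OF \<tau>], unfolded o_def])
      (use tC_D in auto)
  moreover have "\<Phi> ` \<bbbH> \<subseteq> \<bbbH>"
    using disk_to_half_plane_in[OF \<tau> tC_D] by (auto simp: \<Phi>_def)
  moreover have "a n \<in> \<bbbH>" for n
    unfolding a_def using disk_to_half_plane_in[OF \<tau> \<phi>0_D] by blast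
  moreover have "a (Suc n) = \<Phi> (a n)" for n
    using \<phi>_add[of "real n * t"] t \<phi>0_D[of n]
    by (simp add: a_def \<Phi>_def half_plane_to_disk_inverse[OF \<tau>] distrib_right)
  moreover have "filterlim a at_infinity sequentially"
  proof -
    have "filterlim (\<lambda>n. real n * t) at_top sequentially"
      using t by (intro filterlim_at_top_mult_tendsto_pos[OF tendsto_const _ filterlim_real_sequentially])
    moreover have "((\<lambda>s. \<phi> s 0) \<longlongrightarrow> \<tau>) at_top" using dw by (simp add: denjoy_wolff_point_def)
    ultimately have lim: "(\<lambda>n. \<phi> (real n * t) 0) \<longlonglongrightarrow> \<tau>" by (rule filterlim_compose[rotated])
    then have "filterlim (\<lambda>n. \<phi> (real n * t) 0) (at \<tau>) sequentially"
      using tau_ne(1)[OF \<tau> \<phi>0_D] by (simp add: filterlim_at eq_commute[of _ \<tau>])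
    moreover have "filterlim ?W at_infinity (at \<tau>)"
      unfolding disk_to_half_plane_def
    proof (rule filterlim_divide_at_infinity)
      show "((\<lambda>z. \<i> * (\<tau> + z)) \<longlongrightarrow> \<i> * (\<tau> + \<tau>)) (at \<tau>)" by (intro tendsto_intros)
      show "filterlim (\<lambda>z. \<tau> - z) (at 0) (at \<tau>)"
        by (auto simp: filterlim_at eventually_at_filter intro!: tendsto_eq_intros)
      show "\<i> * (\<tau> + \<tau>) \<noteq> 0" using \<tau> by auto
    qed
    ultimately show ?thesis unfolding a_def by (rule filterlim_compose[rotated])
  qed
  moreover have "?W z \<in> \<bbbH>" using disk_to_half_plane_in[OF \<tau> z] .
  ultimately have "Im (?W z) \<le> Im (\<Phi> (?W z))" by (rule julia_wolff_half_plane)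
  then show ?thesis by (simp add: \<Phi>_def half_plane_to_disk_inverse[OF \<tau> z])
qed

text \<open>The functions \<open>E n = exp (i W \<circ> \<phi> n)\<close> are bounded by \<open>1\<close>, and their moduli decrease with \<open>n\<close>. By Montel's
  theorem a subsequence converges to some \<open>G\<close>, whose modulus is then the limit of the full sequence
  of moduli and so is invariant under the semigroup. Finite shift keeps \<open>E n\<close> away from \<open>0\<close> at one point,
  so \<open>G\<close> has no zeros by Hurwitz' theorem. Thus \<open>|G| = |c| exp (- \<kappa> Im h)\<close>, and this is at most
  \<open>|E 0| = exp (- Im W)\<close>.\<close>

lemma finite_shift_im_bound:
  assumes fs: "finite_shift \<phi>" and h: "koenigs_function \<phi> h"
  obtains \<tau> and \<kappa> B :: real where "norm \<tau> = 1"
    "\<And>z. z \<in> \<bbbD> \<Longrightarrow> Im (disk_to_half_plane \<tau> z) \<le> \<kappa> * Im (h z) + B"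
proof -
  have \<phi>: "disk_semigroup \<phi>" using fs by (simp add: finite_shift_def non_elliptic_semigroup_def)
  obtain \<tau> z\<^sub>0 r where dw: "denjoy_wolff_point \<phi> \<tau>" and z0: "z\<^sub>0 \<in> \<bbbD>" and r: "0 < r" "r < 1"
    and out: "(\<lambda>t. \<phi> t z\<^sub>0) ` {0..} \<inter> horodisk \<tau> r = {}"
    using fs by (auto simp: finite_shift_def)
  have \<tau>: "norm \<tau> = 1" using dw by (simp add: denjoy_wolff_point_def)
  have \<phi>_hol: "\<phi> t holomorphic_on \<bbbD>" and \<phi>_D: "z \<in> \<bbbD> \<Longrightarrow> \<phi> t z \<in> \<bbbD>" if "t \<ge> 0" for t z
    using \<phi> that unfolding disk_semigroup_def by blast+
  have \<phi>_add: "\<phi> (t + s) z = \<phi> t (\<phi> s z)" if "t \<ge> 0" "s \<ge> 0" "z \<in> \<bbbD>" for s t z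
    using \<phi> that by (simp add: disk_semigroup_def)
  have \<phi>_0: "\<phi> 0 z = z" if "z \<in> \<bbbD>" for z using \<phi> that by (simp add: disk_semigroup_def)
  define P where "P z = Im (disk_to_half_plane \<tau> z)" for z
  have P_mono: "P z \<le> P (\<phi> t z)" if "t \<ge> 0" "z \<in> \<bbbD>" for t z
    unfolding P_def using im_half_plane_flow_mono[OF \<phi> dw that] .
  have P_pos: "P z > 0" if "z \<in> \<bbbD>" for z
    using disk_to_half_plane_in[OF \<tau> that] by (simp add: P_def)
  define E where "E n z = exp (\<i> * disk_to_half_plane \<tau> (\<phi> (real n) z))" for n z
  have norm_E: "norm (E n z) = exp (- P (\<phi> (real n) z))" for n z by (simp add: E_def P_def)
  have E_hol: "E n holomorphic_on \<bbbD>" for n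
  proof -
    have "(\<lambda>z. disk_to_half_plane \<tau> (\<phi> (real n) z)) holomorphic_on \<bbbD>"
      by (rule holomorphic_on_compose_gen[OF \<phi>_hol holomorphic_disk_to_half_plane[OF \<tau>], unfolded o_def])
        (use \<phi>_D in auto)
    then show ?thesis unfolding E_def[abs_def] by (intro holomorphic_intros)
  qed
  have E_le_1: "norm (E n z) \<le> 1" if "z \<in> \<bbbD>" for n z
    using P_pos[OF \<phi>_D[of "real n" z]] that by (simp add: norm_E)
  have bounded: "\<exists>B. \<forall>g\<in>range E. \<forall>z\<in>K. norm (g z) \<le> B" if "K \<subseteq> \<bbbD>" for K
    using E_le_1 that by (intro exI[of _ 1]) auto
  obtain G k where G: "G holomorphic_on \<bbbD>" and k: "strict_mono (k :: nat \<Rightarrow> nat)"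
    and G_lim: "\<And>z. z \<in> \<bbbD> \<Longrightarrow> (\<lambda>n. E (k n) z) \<longlonglongrightarrow> G z"
    and G_unif: "\<And>K. compact K \<Longrightarrow> K \<subseteq> \<bbbD> \<Longrightarrow> uniform_limit K (E \<circ> k) G sequentially"
  proof (rule Montel[of \<bbbD> "range E" E])
    show "g holomorphic_on \<bbbD>" if "g \<in> range E" for g using that E_hol by auto
    show "\<exists>B. \<forall>g\<in>range E. \<forall>z\<in>K. norm (g z) \<le> B" if "compact K" "K \<subseteq> \<bbbD>" for K
      using bounded[OF that(2)] .
  qed auto
  have dec: "decseq (\<lambda>n. norm (E n z))" if z: "z \<in> \<bbbD>" for z
  proof (rule decseq_SucI)
    fix n
    have "P (\<phi> (real n) z) \<le> P (\<phi> 1 (\<phi> (real n) z))" using P_mono \<phi>_D z by simp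
    also have "\<phi> 1 (\<phi> (real n) z) = \<phi> (real (Suc n)) z" using \<phi>_add[of 1 "real n" z] z by simp
    finally show "norm (E (Suc n) z) \<le> norm (E n z)" by (simp add: norm_E)
  qed
  have norm_lim: "(\<lambda>n. norm (E n z)) \<longlonglongrightarrow> norm (G z)" if z: "z \<in> \<bbbD>" for z
  proof -
    obtain l where l: "(\<lambda>n. norm (E n z)) \<longlonglongrightarrow> l"
      using decseq_convergent[OF dec[OF z], of 0] by auto
    then have "(\<lambda>n. norm (E (k n) z)) \<longlonglongrightarrow> l"
      using LIMSEQ_subseq_LIMSEQ[OF l k] by (simp add: o_def)
    moreover have "(\<lambda>n. norm (E (k n) z)) \<longlonglongrightarrow> norm (G z)" by (rule tendsto_norm[OF G_lim[OF z]])
    ultimately have "l = norm (G z)" by (rule LIMSEQ_unique)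
    with l show ?thesis by simp
  qed
  have inv: "norm (G (\<phi> t z)) = norm (G z)" if t: "t \<ge> 0" and z: "z \<in> \<bbbD>" for t z
  proof (rule antisym)
    have tz: "\<phi> t z \<in> \<bbbD>" using \<phi>_D t z by simp
    show "norm (G (\<phi> t z)) \<le> norm (G z)"
    proof (rule LIMSEQ_le[OF norm_lim[OF tz] norm_lim[OF z]], intro exI[of _ 0] allI impI)
      fix n
      have "\<phi> (real n) (\<phi> t z) = \<phi> t (\<phi> (real n) z)"
        using \<phi>_add[of t "real n" z] \<phi>_add[of "real n" t z] t z by (simp add: add.commute)
      then show "norm (E n (\<phi> t z)) \<le> norm (E n z)"
        using P_mono[OF t \<phi>_D[of "real n" z]] z by (simp add: norm_E)
    qed
    \<comment> \<open>the orbit of \<open>\<phi> t z\<close> at time \<open>n\<close> has reached a point of the orbit of \<open>z\<close> between the times \<open>n\<close> and \<open>n + N\<close>\<close>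
    obtain N where N: "t \<le> real N" using real_arch_simple by blast
    have "(\<lambda>n. norm (E (n + N) z)) \<longlonglongrightarrow> norm (G z)"
      by (rule LIMSEQ_ignore_initial_segment[OF norm_lim[OF z]])
    then show "norm (G z) \<le> norm (G (\<phi> t z))"
    proof (rule LIMSEQ_le[OF _ norm_lim[OF tz]], intro exI[of _ 0] allI impI)
      fix n
      have "\<phi> (real N - t) (\<phi> (real n) (\<phi> t z)) = \<phi> (real (n + N)) z"
        using \<phi>_add[of "real N - t" "real n + t" z] \<phi>_add[of "real n" t z] t z N by (simp add: algebra_simps)
      then show "norm (E (n + N) z) \<le> norm (E n (\<phi> t z))"
        using P_mono[of "real N - t" "\<phi> (real n) (\<phi> t z)"] \<phi>_D[of "real n" "\<phi> t z"] tz N by (simp add: norm_E)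
    qed
  qed
  have G_le: "norm (G z) \<le> exp (- P z)" if z: "z \<in> \<bbbD>" for z
    using decseq_ge[OF dec[OF z] norm_lim[OF z], of 0] \<phi>_0[OF z] by (simp add: norm_E)
  have G_z0: "G z\<^sub>0 \<noteq> 0"
  proof -
    have "exp (- ((1 - r) / r)) \<le> norm (E n z\<^sub>0)" for n
    proof -
      have "\<phi> (real n) z\<^sub>0 \<notin> horodisk \<tau> r" using out by (auto simp: disjoint_iff)
      then have "P (\<phi> (real n) z\<^sub>0) \<le> (1 - r) / r"
        unfolding P_def using \<phi>_D z0 r by (intro Im_disk_to_half_plane_le_outside_horodisk \<tau>) auto
      then show ?thesis by (simp add: norm_E)
    qed
    then have "exp (- ((1 - r) / r)) \<le> norm (G z\<^sub>0)"
      by (intro LIMSEQ_le_const[OF norm_lim[OF z0]]) auto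
    moreover have "exp (- ((1 - r) / r)) > 0" by simp
    ultimately show ?thesis by (metis norm_zero not_le)
  qed
  have G_nz: "G z \<noteq> 0" if z: "z \<in> \<bbbD>" for z
  proof (cases "G constant_on \<bbbD>")
    case True
    then show ?thesis using z z0 G_z0 unfolding constant_on_def by metis
  next
    case False
    show ?thesis
    proof (rule Hurwitz_no_zeros[OF open_ball connected_ball _ G G_unif False _ z])
      show "(E \<circ> k) n holomorphic_on \<bbbD>" for n using E_hol[of "k n"] by simp
      show "(E \<circ> k) n z \<noteq> 0" for n z by (simp add: E_def)
    qed
  qed
  have "\<exists>c \<kappa>. \<forall>z\<in>\<bbbD>. G z = c * exp (\<i> * of_real \<kappa> * h z)"
  proof (rule invariant_modulus_is_exp_koenigs[OF \<phi> h G])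
    show "z \<in> \<bbbD> \<Longrightarrow> G z \<noteq> 0" for z by (rule G_nz)
    show "t \<ge> 0 \<Longrightarrow> z \<in> \<bbbD> \<Longrightarrow> norm (G (\<phi> t z)) = norm (G z)" for t z by (rule inv)
  qed blast
  then obtain c \<kappa> where c: "G z = c * exp (\<i> * of_real \<kappa> * h z)" if "z \<in> \<bbbD>" for z
    by blast
  have c0: "c \<noteq> 0" using c[OF z0] G_z0 by auto
  have "P z \<le> \<kappa> * Im (h z) + (- ln (norm c))" if z: "z \<in> \<bbbD>" for z
  proof -
    have "norm (G z) = norm c * exp (- (\<kappa> * Im (h z)))" by (simp add: c[OF z] norm_mult)
    also have "\<dots> = exp (ln (norm c) - \<kappa> * Im (h z))" using c0 by (simp add: exp_diff exp_minus divide_inverse)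
    finally have "exp (ln (norm c) - \<kappa> * Im (h z)) \<le> exp (- P z)" using G_le[OF z] by simp
    then show ?thesis by simp
  qed
  then show thesis using that \<tau> unfolding P_def by blast
qed

section \<open>Growth along rays\<close>

lemma exp_dominates_powr:
  fixes c \<delta> M N :: real
  assumes "c > 0" "\<delta> > 0"
  shows "\<not> (\<forall>\<^sub>F s in at_top. c * exp (\<delta> * s) \<le> 1 + M * s powr N)"
proof
  assume ev: "\<forall>\<^sub>F s in at_top. c * exp (\<delta> * s) \<le> 1 + M * s powr N"
  have "((\<lambda>s. s powr N / exp (\<delta> * s)) \<longlongrightarrow> 0) at_top" "((\<lambda>s. 1 / exp (\<delta> * s)) \<longlongrightarrow> 0) at_top"
    using assms by real_asymp+
  then have "((\<lambda>s. 1 / exp (\<delta> * s) + M * (s powr N / exp (\<delta> * s))) \<longlongrightarrow> 0 + M * 0) at_top"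
    by (intro tendsto_intros)
  moreover have "\<forall>\<^sub>F s in at_top. c \<le> 1 / exp (\<delta> * s) + M * (s powr N / exp (\<delta> * s))"
    using ev
  proof eventually_elim
    case (elim s)
    then have "c \<le> (1 + M * s powr N) / exp (\<delta> * s)" by (simp add: le_divide_eq)
    then show ?case by (simp add: add_divide_distrib)
  qed
  ultimately have "c \<le> 0 + M * 0" by (intro tendsto_lowerbound) auto
  with assms show False by simp
qed

text \<open>The slope \<open>c\<close> is that of the Julia-Caratheodory theorem. It cannot vanish because
  \<open>s = Im W \<le> \<kappa> Im h + B\<close> on the imaginary axis forces \<open>1 \<le> \<kappa> c\<close>.\<close>

lemma koenigs_ray_asymptotics:
  assumes fs: "finite_shift \<phi>" and h: "koenigs_function \<phi> h" and range: "h ` \<bbbD> \<subseteq> \<bbbH>"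
  obtains \<tau> and c :: real where "norm \<tau> = 1" "c > 0"
    "\<And>e. norm e = 1 \<Longrightarrow> Im e > 0 \<Longrightarrow>
      ((\<lambda>s. h (half_plane_to_disk \<tau> (of_real s * e)) / of_real s) \<longlongrightarrow> of_real c * e) at_top"
proof -
  obtain \<tau> \<kappa> B where \<tau>: "norm \<tau> = 1"
    and bound: "\<And>z. z \<in> \<bbbD> \<Longrightarrow> Im (disk_to_half_plane \<tau> z) \<le> \<kappa> * Im (h z) + B"
    using finite_shift_im_bound[OF fs h] by blast
  let ?C = "half_plane_to_disk \<tau>"
  have C: "?C w \<in> \<bbbD>" if "w \<in> \<bbbH>" for w using half_plane_to_disk_in[OF \<tau> that] .
  have hol: "(\<lambda>w. h (?C w)) holomorphic_on \<bbbH>"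
    by (rule holomorphic_on_compose_gen[OF holomorphic_half_plane_to_disk[OF \<tau>], unfolded o_def])
      (use h C in \<open>auto simp: koenigs_function_def\<close>)
  have hC: "Im (h (?C w)) > 0" if "w \<in> \<bbbH>" for w using range C[OF that] by blast
  then have "(\<lambda>w. h (?C w)) ` \<bbbH> \<subseteq> \<bbbH>" by auto
  from julia_caratheodory_half_plane[OF hol this] obtain c :: real where
    c: "((\<lambda>s. h (?C (of_real s * e)) / of_real s) \<longlongrightarrow> of_real c * e) at_top"
      if "norm e = 1" "Im e > 0" for e
    by metis
  have "((\<lambda>s. h (?C (of_real s * \<i>)) / of_real s) \<longlongrightarrow> of_real c * \<i>) at_top" by (rule c) auto
  then have lim: "((\<lambda>s. Im (h (?C (of_real s * \<i>))) / s) \<longlongrightarrow> c) at_top"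
    using tendsto_Im by fastforce
  have "c \<ge> 0"
  proof (rule tendsto_lowerbound[OF lim])
    show "\<forall>\<^sub>F s in at_top. 0 \<le> Im (h (?C (of_real s * \<i>))) / s"
      using eventually_gt_at_top[of 0]
    proof eventually_elim
      case (elim s)
      then show ?case using hC[of "of_real s * \<i>"] by simp
    qed
  qed simp
  moreover have "1 \<le> \<kappa> * c + 0"
  proof (rule tendsto_lowerbound)
    have "((\<lambda>s. B / s) \<longlongrightarrow> 0) at_top" by real_asymp
    then show "((\<lambda>s. \<kappa> * (Im (h (?C (of_real s * \<i>))) / s) + B / s) \<longlongrightarrow> \<kappa> * c + 0) at_top"
      by (intro tendsto_intros lim)
    show "\<forall>\<^sub>F s in at_top. 1 \<le> \<kappa> * (Im (h (?C (of_real s * \<i>))) / s) + B / s"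
      using eventually_gt_at_top[of 0]
    proof eventually_elim
      case (elim s)
      then have w: "of_real s * \<i> \<in> \<bbbH>" by simp
      have "s \<le> \<kappa> * Im (h (?C (of_real s * \<i>))) + B"
        using bound[OF C[OF w]] by (simp add: disk_to_half_plane_inverse[OF \<tau> w])
      then have "s / s \<le> (\<kappa> * Im (h (?C (of_real s * \<i>))) + B) / s"
        using elim by (intro divide_right_mono) auto
      then show ?case using elim by (simp add: add_divide_distrib)
    qed
  qed simp
  ultimately have "c > 0" by (cases "c = 0") auto
  then show thesis using that \<tau> c by blast
qed

text \<open>Along a ray the Cayley transform turns \<open>1 - |z|\<close> into a quantity of order \<open>1 / s\<close>.\<close>

lemma bergman_growth_on_ray:
  assumes f: "f \<in> bergman_space p \<alpha>" and p: "p \<ge> 1" and \<tau>: "norm \<tau> = 1"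
    and e: "norm e = 1" "Im e > 0"
  obtains M where "\<forall>\<^sub>F s in at_top. norm (f (half_plane_to_disk \<tau> (of_real s * e))) \<le> 1 + M * s powr (\<bar>\<alpha>\<bar> + 2)"
proof
  define N where "N = \<bar>\<alpha>\<bar> + 2"
  define I where "I = bergman_norm p \<alpha> f powr p"
  show "\<forall>\<^sub>F s in at_top. norm (f (half_plane_to_disk \<tau> (of_real s * e)))
      \<le> 1 + (4 / Im e) powr N * I * s powr (\<bar>\<alpha>\<bar> + 2)"
    using eventually_ge_at_top[of 1]
  proof eventually_elim
    case (elim s)
    define w where "w = of_real s * e"
    define z where "z = half_plane_to_disk \<tau> w"
    have w: "w \<in> \<bbbH>" using elim e by (simp add: w_def)
    have z: "z \<in> \<bbbD>" unfolding z_def by (rule half_plane_to_disk_in[OF \<tau> w])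
    have "norm (w + \<i>) \<le> 2 * s"
      using norm_triangle_ineq[of w \<i>] e elim by (simp add: w_def norm_mult)
    then have "(norm (w + \<i>))\<^sup>2 \<le> (2 * s)\<^sup>2" by (rule power_mono) simp
    then have "4 * Im w / (2 * s)\<^sup>2 \<le> 4 * Im w / (norm (w + \<i>))\<^sup>2"
      using w half_plane_ne[OF w] elim by (intro divide_left_mono mult_pos_pos) auto
    also have "\<dots> = 1 - (norm z)\<^sup>2" by (simp add: z_def one_minus_norm_half_plane_to_disk[OF \<tau> w])
    also have "\<dots> = (1 - norm z) * (1 + norm z)" by (simp add: power2_eq_square algebra_simps)
    also have "\<dots> \<le> (1 - norm z) * 2" using z by (intro mult_left_mono) auto
    also have "4 * Im w / (2 * s)\<^sup>2 = Im e / s" using elim by (simp add: w_def power2_eq_square)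
    finally have "Im e / (4 * s) \<le> (1 - norm z) / 2" by (simp add: field_simps)
    moreover have pos: "Im e / (4 * s) > 0" using e elim by simp
    ultimately have "((1 - norm z) / 2) powr (- N) \<le> (Im e / (4 * s)) powr (- N)"
      by (intro powr_mono2') (auto simp: N_def)
    also have "\<dots> = (4 / Im e * s) powr N"
      using pos by (simp add: powr_minus_divide powr_divide)
    also have "\<dots> = (4 / Im e) powr N * s powr N"
      using e elim by (intro powr_mult)
    finally have P: "((1 - norm z) / 2) powr (- N) \<le> (4 / Im e) powr N * s powr N" .
    have "norm (f z) \<le> 1 + ((1 - norm z) / 2) powr (- N) * I"
      using bergman_point_evaluation[OF f p z, of 1] by (simp add: N_def I_def)
    also have "\<dots> \<le> 1 + (4 / Im e) powr N * s powr N * I"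
      using P by (intro add_left_mono mult_right_mono) (auto simp: I_def)
    finally show ?case by (simp add: z_def w_def N_def mult_ac)
  qed
qed

text \<open>For \<open>Re \<mu> \<noteq> 0\<close> a direction works that is tilted far enough to the left or right, according to the
  sign of \<open>Re \<mu>\<close>; for \<open>\<mu>\<close> on the negative imaginary axis the vertical direction does.\<close>

lemma rotation_with_positive_real_part:
  assumes "\<not> (\<exists>t\<ge>0. \<mu> = \<i> * of_real t)"
  obtains e where "norm e = 1" "Im e > 0" "Re (\<mu> * e) > 0"
proof -
  define a b where "a = Re \<mu>" and "b = Im \<mu>"
  have ab: "a \<noteq> 0 \<or> b < 0"
    using assms by (force simp: a_def b_def complex_eq_iff not_less)
  define v where "v = Complex (if a = 0 then 0 else (\<bar>b\<bar> + 1) / a) 1"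
  have "Re (\<mu> * v) = (if a = 0 then - b else \<bar>b\<bar> + 1 - b)" by (simp add: v_def a_def b_def)
  then have v: "Re (\<mu> * v) > 0" using ab by auto
  have v1: "Im v = 1" "v \<noteq> 0" by (auto simp: v_def complex_eq_iff)
  show thesis
  proof
    show "norm (v / of_real (norm v)) = 1" using v1 by (simp add: norm_divide)
    show "Im (v / of_real (norm v)) > 0" using v1 by simp
    have "\<mu> * (v / of_real (norm v)) = (\<mu> * v) / of_real (norm v)" by simp
    then show "Re (\<mu> * (v / of_real (norm v))) > 0"
      using v v1 by (simp only: Re_divide_of_real) simp
  qed
qed

section \<open>The point spectrum\<close>

text \<open>Norm convergence implies pointwise convergence, so the eigenvalue equation becomes the differential
  equation \<open>f' / h' = \<mu> f\<close>.\<close>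

lemma generator_eigenvector_is_exp_koenigs:
  assumes \<phi>: "disk_semigroup \<phi>" and h: "koenigs_function \<phi> h" and p: "p \<ge> 1"
    and gen: "bergman_generator p \<alpha> \<phi> f g" and g: "\<And>z. z \<in> \<bbbD> \<Longrightarrow> g z = \<mu> * f z"
  obtains c where "\<And>z. z \<in> \<bbbD> \<Longrightarrow> f z = c * exp (\<mu> * h z)"
proof -
  have f: "f holomorphic_on \<bbbD>" using gen by (simp add: bergman_generator_def bergman_space_def)
  have "deriv f z = \<mu> * f z * deriv h z" if z: "z \<in> \<bbbD>" for z
  proof -
    have "((\<lambda>t. (composition_semigroup \<phi> t f z - f z) / of_real t) \<longlongrightarrow> g z) (at_right 0)"
      by (rule bergman_tendsto_imp_pointwise[OF _ p z, where \<alpha> = \<alpha>])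
        (use gen in \<open>simp add: bergman_generator_def\<close>)
    then have "((\<lambda>t. (f (\<phi> t z) - f z) / of_real t) \<longlongrightarrow> g z) (at_right 0)"
      by (simp add: composition_semigroup_def)
    then have "g z = deriv f z / deriv h z"
      using flow_difference_quotient[OF \<phi> h f z] by (rule tendsto_unique[rotated]) simp
    then show ?thesis using deriv_koenigs_nonzero[OF h z] by (simp add: g[OF z] field_simps)
  qed
  then show thesis using exp_ode_solution[OF f] h that by (metis koenigs_function_def)
qed

theorem corollary5p11:
  fixes \<phi> :: "real \<Rightarrow> complex \<Rightarrow> complex" and h :: "complex \<Rightarrow> complex" and p \<alpha> :: real
  assumes "finite_shift \<phi>"
    and "koenigs_function \<phi> h"
    and "h ` \<bbbD> \<subseteq> {w. Im w > 0}"
    and "p \<ge> 1" and "\<alpha> > -1"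
  shows "generator_point_spectrum p \<alpha> \<phi> = {\<i> * of_real t | t. t \<ge> 0}"
proof (intro equalityI subsetI)
  note fs = assms(1) and h = assms(2) and range = assms(3) and p = assms(4)
  have \<phi>: "disk_semigroup \<phi>" using fs by (simp add: finite_shift_def non_elliptic_semigroup_def)
  fix \<mu> assume "\<mu> \<in> generator_point_spectrum p \<alpha> \<phi>"
  then obtain f g z\<^sub>0 where gen: "bergman_generator p \<alpha> \<phi> f g" and z0: "z\<^sub>0 \<in> \<bbbD>" "f z\<^sub>0 \<noteq> 0"
    and g: "\<And>z. z \<in> \<bbbD> \<Longrightarrow> g z = \<mu> * f z"
    unfolding generator_point_spectrum_def by blast
  obtain C where f_eq: "\<And>z. z \<in> \<bbbD> \<Longrightarrow> f z = C * exp (\<mu> * h z)"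
    using generator_eigenvector_is_exp_koenigs[OF \<phi> h p gen g] by blast
  have C: "C \<noteq> 0" using f_eq[OF z0(1)] z0(2) by auto
  \<comment> \<open>for any other \<open>\<mu>\<close>, \<open>f\<close> would grow exponentially along a ray, faster than the space allows\<close>
  show "\<mu> \<in> {\<i> * of_real t | t. t \<ge> 0}"
  proof (rule ccontr)
    assume "\<not> ?thesis"
    then have "\<not> (\<exists>t\<ge>0. \<mu> = \<i> * of_real t)" by blast
    then obtain e where e: "norm e = 1" "Im e > 0" "Re (\<mu> * e) > 0"
      by (rule rotation_with_positive_real_part)
    obtain \<tau> c where \<tau>: "norm \<tau> = 1" and c: "c > 0"
      and ray: "((\<lambda>s. h (half_plane_to_disk \<tau> (of_real s * e)) / of_real s) \<longlongrightarrow> of_real c * e) at_top"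
      using koenigs_ray_asymptotics[OF fs h range] e by metis
    define Z where "Z s = half_plane_to_disk \<tau> (of_real s * e)" for s :: real
    define \<delta> where "\<delta> = c * Re (\<mu> * e) / 2"
    have \<delta>: "\<delta> > 0" using c e by (simp add: \<delta>_def)
    have "((\<lambda>s. Re (\<mu> * (h (Z s) / of_real s))) \<longlongrightarrow> Re (\<mu> * (of_real c * e))) at_top"
      unfolding Z_def by (intro tendsto_intros ray)
    moreover have "Re (\<mu> * (of_real c * e)) = 2 * \<delta>"
      by (simp add: \<delta>_def algebra_simps)
    ultimately have "\<forall>\<^sub>F s in at_top. \<delta> < Re (\<mu> * (h (Z s) / of_real s))"
      using \<delta> by (intro order_tendstoD) auto
    then have lower: "\<forall>\<^sub>F s in at_top. norm C * exp (\<delta> * s) \<le> norm (f (Z s))"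
      using eventually_gt_at_top[of 0]
    proof eventually_elim
      case (elim s)
      have "of_real s * e \<in> \<bbbH>" using elim e by simp
      then have "Z s \<in> \<bbbD>" unfolding Z_def by (rule half_plane_to_disk_in[OF \<tau>])
      moreover have "\<mu> * (h (Z s) / of_real s) = (\<mu> * h (Z s)) / of_real s" by simp
      then have "\<delta> < Re (\<mu> * h (Z s)) / s" using elim(1) by (simp only: Re_divide_of_real)
      then have "\<delta> * s \<le> Re (\<mu> * h (Z s))" using elim(2) by (simp add: less_divide_eq)
      ultimately show ?case by (simp add: f_eq norm_mult mult_left_mono del: times_complex.sel)
    qed
    have "f \<in> bergman_space p \<alpha>" using gen by (simp add: bergman_generator_def)
    then obtain M where "\<forall>\<^sub>F s in at_top. norm (f (Z s)) \<le> 1 + M * s powr (\<bar>\<alpha>\<bar> + 2)"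
      unfolding Z_def using bergman_growth_on_ray[OF _ p \<tau> e(1,2)] by blast
    with lower have "\<forall>\<^sub>F s in at_top. norm C * exp (\<delta> * s) \<le> 1 + M * s powr (\<bar>\<alpha>\<bar> + 2)"
      by eventually_elim (rule order_trans)
    then show False using exp_dominates_powr[of "norm C" \<delta>] C \<delta> by simp
  qed
next
  note h = assms(2) and range = assms(3) and p = assms(4) and \<alpha> = assms(5)
  fix \<mu> assume "\<mu> \<in> {\<i> * complex_of_real t | t. t \<ge> 0}"
  then obtain t where t: "t \<ge> 0" and \<mu>: "\<mu> = \<i> * of_real t" by blast
  have "(\<lambda>z. exp (\<mu> * h z)) \<in> bergman_space p \<alpha>"
  proof (rule bounded_in_bergman_space)
    show "(\<lambda>z. exp (\<mu> * h z)) holomorphic_on \<bbbD>"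
      using h by (intro holomorphic_intros) (simp add: koenigs_function_def)
    show "norm (exp (\<mu> * h z)) \<le> 1" if "z \<in> \<bbbD>" for z
    proof -
      have "Im (h z) > 0" using range that by blast
      then show ?thesis using t by (simp add: \<mu>)
    qed
  qed (use p \<alpha> in auto)
  then show "\<mu> \<in> generator_point_spectrum p \<alpha> \<phi>"
    using exp_koenigs_eigenvector[OF h] p by simp
qed

end
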